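(* Let $F:\mathcal{A}\to\mathcal{C}$ be a faithful $\mathcal{M}$-fibration and let $\mathcal{B}$ be a base for a quasi-uniformity $\mathcal{U}$ on $\mathcal{C}$ with respect to $\mathcal{M}$. For $X\in\mathcal{A}$ put $$\mathcal{B}^F_X=\{U^F\;|\;U\in\mathcal{B}_{FX}\},\qquad U^F(m)=\delta_X(U(Fm))\quad(m\in\mathrm{sub}X).$$ Then $\mathcal{B}^F$ is a base for a quasi-uniformity $\mathcal{U}^F$ on $\mathcal{A}$ with respect to $\mathcal{M}_F$. It is the coarsest quasi-uniformity on $\mathcal{A}$ for which $F$ is $(\mathcal{U}^F,\mathcal{U})$-continuous. $\mathcal{B}^F$ is transitive provided that $\mathcal{B}$ is a transitive base. Moreover, an $\mathcal{A}$-morphism $f$ is $\mathcal{U}^F$-initial provided $Ff$ is $\mathcal{U}$-initial.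
   Context: $\mathcal{C}$ is a category with a proper $(\mathcal{E},\mathcal{M})$-factorization system for morphisms ($\mathcal{E}$ consists of epimorphisms, $\mathcal{M}$ of monomorphisms), and it is $\mathcal{M}$-complete: pullbacks of $\mathcal{M}$-morphisms along arbitrary morphisms and arbitrary $\mathcal{M}$-intersections exist and are again in $\mathcal{M}$. For $X\in\mathcal{C}$, $\mathrm{sub}X=\{m\in\mathcal{M}\mid \mathrm{cod}(m)=X\}$, ordered by $n\le m$ iff $m\circ j=n$ for some $j$; isomorphic subobjects are identified, so $\mathrm{sub}X$ is a (possibly large) complete lattice. For $f:X\to Y$, $f(m)$ is the $\mathcal{M}$-component of the factorization of $f\circ m$ and $f^{-1}(n)$ is the pullback of $n$ along $f$. A morphism $f:X\to Y$ of $\mathcal{A}$ is $F$-initial ($F$-cartesian) if for every $h:Z\to Y$ in $\mathcal{A}$ and $u:FZ\to FX$ with $Ff\circ u=Fh$ there is a unique $v:Z\to X$ with $Fv=u$ and $f\circ v=h$; $\mathrm{Ini}F$ is the class of these. A faithful functor $F:\mathcal{A}\to\mathcal{C}$ is an $\mathcal{M}$-fibration if every $g:A\to FY$ with $g\in\mathcal{M}$ has an $F$-initial lifting. Then $\mathcal{A}$ carries the factorization system $(\mathcal{E}_F,\mathcal{M}_F)$, $\mathcal{E}_F=F^{-1}\mathcal{E}$, $\mathcal{M}_F=F^{-1}\mathcal{M}\cap\mathrm{Ini}F$, and is $\mathcal{M}_F$-complete; for $X\in\mathcal{A}$, $\mathrm{sub}X$ and images/inverse images are formed with respect to $\mathcal{M}_F$.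 The maps $\gamma_X:\mathrm{sub}X\to\mathrm{sub}FX$, $\gamma_X(m)=Fm$, and $\delta_X:\mathrm{sub}FX\to\mathrm{sub}X$, $\delta_X(n)=p$ with $Fp=n$ and $p\in\mathrm{Ini}F$, are mutually inverse order equivalences, and $F$ preserves images and inverse images of subobjects. The following notions are for $\mathcal{C}$ with $\mathcal{M}$ and likewise for $\mathcal{A}$ with $\mathcal{M}_F$. A quasi-uniformity is a family $\mathcal{U}=\{\mathcal{U}_X\}$ indexed by objects, each $\mathcal{U}_X$ a collection of order-preserving maps $\mathrm{sub}X\to\mathrm{sub}X$ (ordered pointwise), such that (U1) $m\le U(m)$ for all $m$ and $U\in\mathcal{U}_X$; (U2) for $U\in\mathcal{U}_X$ there is $U'\in\mathcal{U}_X$ with $U'\circ U'\le U$; (U3) $U\in\mathcal{U}_X$, $U\le U'$ imply $U'\in\mathcal{U}_X$; (U4) $U,U'\in\mathcal{U}_X$ imply $U\wedge U'\in\mathcal{U}_X$; (U5) for $f:X\to Y$ and $U\in\mathcal{U}_Y$ there is $U'\in\mathcal{U}_X$ with $f(U'(m))\le U(f(m))$ for all $m\in\mathrm{sub}X$. A base is a family $\mathcal{B}=\{\mathcal{B}_X\}$ satisfying all of these except (U3); the quasi-uniformity it generates consists of all $V$ lying above some member of the base. A base is transitive if $U\circ U=U$ for all its members. Order: $\mathcal{U}\le\mathcal{V}$ iff for all $X$ and $U\in\mathcal{U}_X$ there is $V\in\mathcal{V}_X$ with $V\le U$; "coarsest" means least. A morphism $f:X\to Y$ is $\mathcal{U}$-initial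 if for every $U\in\mathcal{U}_X$ there is $U'\in\mathcal{U}_Y$ with $f^{-1}(U'(f(p)))\le U(p)$ for all $p\in\mathrm{sub}X$. For quasi-uniformities $\mathcal{W}$ on $\mathcal{A}$ and $\mathcal{U}$ on $\mathcal{C}$, $F$ is $(\mathcal{W},\mathcal{U})$-continuous if for all $X\in\mathcal{A}$ and $U\in\mathcal{U}_{FX}$ there is $W\in\mathcal{W}_X$ such that $F(W(m))\le U(Fm)$ for all $m\in\mathrm{sub}X$. *)

theory Defs
  imports "HOL-Algebra.Lattice"
begin

section \<open>Categories and functors\<close>

record ('o, 'a) category =
  Obj :: "'o set"
  Arr :: "'a set"
  Dom :: "'a \<Rightarrow> 'o"
  Cod :: "'a \<Rightarrow> 'o"
  Ident :: "'o \<Rightarrow> 'a"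
  Comp :: "'a \<Rightarrow> 'a \<Rightarrow> 'a"  (infixr \<open>\<cdot>\<index>\<close> 70)

definition Hom :: "('o, 'a) category \<Rightarrow> 'o \<Rightarrow> 'o \<Rightarrow> 'a set" where
  "Hom C X Y = {f \<in> Arr C. Dom C f = X \<and> Cod C f = Y}"

text \<open>The composite \<open>g \<cdot>\<^bsub>C\<^esub> f\<close> is unspecified unless \<open>Cod C f = Dom C g\<close>.\<close>

locale category =
  fixes C :: "('o, 'a) category" (structure)
  assumes Dom_in_Obj: "f \<in> Arr C \<Longrightarrow> Dom C f \<in> Obj C"
    and Cod_in_Obj: "f \<in> Arr C \<Longrightarrow> Cod C f \<in> Obj C"
    and Ident_in_Hom: "X \<in> Obj C \<Longrightarrow> Ident C X \<in> Hom C X X"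
    and Comp_in_Hom: "\<lbrakk>f \<in> Hom C X Y; g \<in> Hom C Y Z\<rbrakk> \<Longrightarrow> g \<cdot> f \<in> Hom C X Z"
    and Comp_Ident: "f \<in> Hom C X Y \<Longrightarrow> f \<cdot> Ident C X = f"
    and Ident_Comp: "f \<in> Hom C X Y \<Longrightarrow> Ident C Y \<cdot> f = f"
    and Comp_assoc: "\<lbrakk>f \<in> Hom C W X; g \<in> Hom C X Y; h \<in> Hom C Y Z\<rbrakk>
      \<Longrightarrow> (h \<cdot> g) \<cdot> f = h \<cdot> (g \<cdot> f)"

locale cat_functor = A: category A + C: category C
  for A :: "('p, 'b) category" and C :: "('o, 'a) category" +
  fixes Fo :: "'p \<Rightarrow> 'o" and Fa :: "'b \<Rightarrow> 'a"
  assumes Fo_in_Obj: "X \<in> Obj A \<Longrightarrow> Fo X \<in> Obj C"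
    and Fa_in_Hom: "f \<in> Hom A X Y \<Longrightarrow> Fa f \<in> Hom C (Fo X) (Fo Y)"
    and Fa_Ident: "X \<in> Obj A \<Longrightarrow> Fa (Ident A X) = Ident C (Fo X)"
    and Fa_Comp: "\<lbrakk>f \<in> Hom A X Y; g \<in> Hom A Y Z\<rbrakk> \<Longrightarrow> Fa (g \<cdot>\<^bsub>A\<^esub> f) = Fa g \<cdot>\<^bsub>C\<^esub> Fa f"

locale faithful_functor = cat_functor +
  assumes faithful: "\<lbrakk>f \<in> Hom A X Y; g \<in> Hom A X Y; Fa f = Fa g\<rbrakk> \<Longrightarrow> f = g"

definition is_mono :: "('o, 'a) category \<Rightarrow> 'a \<Rightarrow> bool" where
  "is_mono C m \<longleftrightarrow> m \<in> Arr C \<and>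
     (\<forall>Z. \<forall>g\<in>Hom C Z (Dom C m). \<forall>h\<in>Hom C Z (Dom C m). m \<cdot>\<^bsub>C\<^esub> g = m \<cdot>\<^bsub>C\<^esub> h \<longrightarrow> g = h)"

definition is_epi :: "('o, 'a) category \<Rightarrow> 'a \<Rightarrow> bool" where
  "is_epi C e \<longleftrightarrow> e \<in> Arr C \<and>
     (\<forall>Z. \<forall>g\<in>Hom C (Cod C e) Z. \<forall>h\<in>Hom C (Cod C e) Z. g \<cdot>\<^bsub>C\<^esub> e = h \<cdot>\<^bsub>C\<^esub> e \<longrightarrow> g = h)"

definition is_iso :: "('o, 'a) category \<Rightarrow> 'a \<Rightarrow> bool" where
  "is_iso C j \<longleftrightarrow> j \<in> Arr C \<and>
     (\<exists>k\<in>Hom C (Cod C j) (Dom C j).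
        k \<cdot>\<^bsub>C\<^esub> j = Ident C (Dom C j) \<and> j \<cdot>\<^bsub>C\<^esub> k = Ident C (Cod C j))"

definition is_pullback :: "('o, 'a) category \<Rightarrow> 'a \<Rightarrow> 'a \<Rightarrow> 'a \<Rightarrow> 'a \<Rightarrow> bool" where
  "is_pullback C f n p q \<longleftrightarrow>
     f \<in> Arr C \<and> n \<in> Arr C \<and> Cod C f = Cod C n \<and>
     p \<in> Hom C (Dom C p) (Dom C f) \<and> q \<in> Hom C (Dom C p) (Dom C n) \<and>
     f \<cdot>\<^bsub>C\<^esub> p = n \<cdot>\<^bsub>C\<^esub> q \<and>
     (\<forall>Z. \<forall>g\<in>Hom C Z (Dom C f). \<forall>h\<in>Hom C Z (Dom C n).
        f \<cdot>\<^bsub>C\<^esub> g = n \<cdot>\<^bsub>C\<^esub> h \<longrightarrow>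
        (\<exists>!k. k \<in> Hom C Z (Dom C p) \<and> p \<cdot>\<^bsub>C\<^esub> k = g \<and> q \<cdot>\<^bsub>C\<^esub> k = h))"


section \<open>Factorization systems, subobjects, images and inverse images\<close>

locale proper_factorization_system = category C
  for C :: "('o, 'a) category" (structure) +
  fixes E M :: "'a set"
  assumes E_epi: "e \<in> E \<Longrightarrow> is_epi C e"
    and M_mono: "m \<in> M \<Longrightarrow> is_mono C m"
    and E_iso_closed: "\<lbrakk>e \<in> E; is_iso C j; Cod C e = Dom C j\<rbrakk> \<Longrightarrow> j \<cdot> e \<in> E"
    and M_iso_closed: "\<lbrakk>m \<in> M; is_iso C j; Cod C j = Dom C m\<rbrakk> \<Longrightarrow> m \<cdot> j \<in> M"
    and factorization: "f \<in> Arr C \<Longrightarrow> \<exists>e\<in>E. \<exists>m\<in>M. Cod C e = Dom C m \<and> m \<cdot> e = f"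
    and diagonalization:
      "\<lbrakk>e \<in> E; m \<in> M; f \<in> Hom C (Dom C e) (Dom C m); g \<in> Hom C (Cod C e) (Cod C m);
        m \<cdot> f = g \<cdot> e\<rbrakk>
       \<Longrightarrow> \<exists>!d. d \<in> Hom C (Cod C e) (Dom C m) \<and> d \<cdot> e = f \<and> m \<cdot> d = g"

definition factors_through :: "('o, 'a) category \<Rightarrow> 'a \<Rightarrow> 'a \<Rightarrow> bool" where
  "factors_through C g m \<longleftrightarrow> (\<exists>j\<in>Hom C (Dom C g) (Dom C m). m \<cdot>\<^bsub>C\<^esub> j = g)"

definition is_intersection :: "('o, 'a) category \<Rightarrow> 'o \<Rightarrow> 'a set \<Rightarrow> 'a \<Rightarrow> bool" where
  "is_intersection C X S d \<longleftrightarrow>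
     d \<in> Arr C \<and> Cod C d = X \<and>
     (\<forall>m\<in>S. factors_through C d m) \<and>
     (\<forall>Z. \<forall>g\<in>Hom C Z X. (\<forall>m\<in>S. factors_through C g m) \<longrightarrow>
        (\<exists>!k. k \<in> Hom C Z (Dom C d) \<and> d \<cdot>\<^bsub>C\<^esub> k = g))"

definition M_complete :: "('o, 'a) category \<Rightarrow> 'a set \<Rightarrow> bool" where
  "M_complete C M \<longleftrightarrow>
     (\<forall>f\<in>Arr C. \<forall>n\<in>M. Cod C f = Cod C n \<longrightarrow> (\<exists>p\<in>M. \<exists>q. is_pullback C f n p q)) \<and>
     (\<forall>X\<in>Obj C. \<forall>S \<subseteq> {m \<in> M. Cod C m = X}. \<exists>d\<in>M. is_intersection C X S d)"

text \<open>Since isomorphic subobjects are identified, a subobject of \<open>X\<close> is an isomorphism class of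
  \<open>M\<close>-morphisms with codomain \<open>X\<close>.\<close>

definition sub_iso :: "('o, 'a) category \<Rightarrow> 'a set \<Rightarrow> 'o \<Rightarrow> ('a \<times> 'a) set" where
  "sub_iso C M X =
     {(m, n). m \<in> M \<and> n \<in> M \<and> Cod C m = X \<and> Cod C n = X \<and>
        (\<exists>j\<in>Hom C (Dom C m) (Dom C n). is_iso C j \<and> n \<cdot>\<^bsub>C\<^esub> j = m)}"

definition subobj :: "('o, 'a) category \<Rightarrow> 'a set \<Rightarrow> 'o \<Rightarrow> 'a set gorder" where
  "subobj C M X =
     \<lparr>carrier = {m \<in> M. Cod C m = X} // sub_iso C M X,
      eq = (=),
      le = (\<lambda>c d. \<exists>m\<in>c. \<exists>n\<in>d. factors_through C m n)\<rparr>"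

text \<open>Factorizations and pullbacks are determined up to isomorphism only; the sets below consist of
  all \<open>M\<close>-parts of factorizations, respectively all pullbacks, and so are whole isomorphism
  classes.\<close>

definition sub_image :: "('o, 'a) category \<Rightarrow> 'a set \<Rightarrow> 'a set \<Rightarrow> 'a \<Rightarrow> 'a set \<Rightarrow> 'a set" where
  "sub_image C E M f c = {n \<in> M. \<exists>m\<in>c. \<exists>e\<in>E. Cod C e = Dom C n \<and> n \<cdot>\<^bsub>C\<^esub> e = f \<cdot>\<^bsub>C\<^esub> m}"

definition sub_inv_image :: "('o, 'a) category \<Rightarrow> 'a \<Rightarrow> 'a set \<Rightarrow> 'a set" where
  "sub_inv_image C f d = {p. \<exists>n\<in>d. \<exists>q. is_pullback C f n p q}"


section \<open>\<open>M\<close>-fibrations\<close>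

definition Ini ::
  "('p, 'b) category \<Rightarrow> ('o, 'a) category \<Rightarrow> ('p \<Rightarrow> 'o) \<Rightarrow> ('b \<Rightarrow> 'a) \<Rightarrow> 'b set" where
  "Ini A C Fo Fa =
     {f \<in> Arr A. \<forall>Z\<in>Obj A. \<forall>h\<in>Hom A Z (Cod A f). \<forall>u\<in>Hom C (Fo Z) (Fo (Dom A f)).
        Fa f \<cdot>\<^bsub>C\<^esub> u = Fa h \<longrightarrow>
        (\<exists>!v. v \<in> Hom A Z (Dom A f) \<and> Fa v = u \<and> f \<cdot>\<^bsub>A\<^esub> v = h)}"

locale M_fibration = faithful_functor A C Fo Fa
  for A :: "('p, 'b) category" and C :: "('o, 'a) category"
    and Fo :: "'p \<Rightarrow> 'o" and Fa :: "'b \<Rightarrow> 'a" +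
  fixes M :: "'a set"
  assumes initial_lifting: "\<lbrakk>Y \<in> Obj A; g \<in> M; Cod C g = Fo Y\<rbrakk>
    \<Longrightarrow> \<exists>f\<in>Ini A C Fo Fa. Cod A f = Y \<and> Fa f = g"

definition lift_E :: "('p, 'b) category \<Rightarrow> ('b \<Rightarrow> 'a) \<Rightarrow> 'a set \<Rightarrow> 'b set" where
  "lift_E A Fa E = {e \<in> Arr A. Fa e \<in> E}"

definition lift_M ::
  "('p, 'b) category \<Rightarrow> ('o, 'a) category \<Rightarrow> ('p \<Rightarrow> 'o) \<Rightarrow> ('b \<Rightarrow> 'a) \<Rightarrow> 'a set \<Rightarrow> 'b set" where
  "lift_M A C Fo Fa M = {m \<in> Arr A. Fa m \<in> M} \<inter> Ini A C Fo Fa"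

text \<open>\<open>\<gamma>\<^sub>X\<close> sends the class of \<open>m\<close> to the class of \<open>F m\<close>; \<open>\<delta>\<^sub>X\<close> sends the class of \<open>n\<close> to the
  class of all \<open>F\<close>-initial liftings \<open>p\<close> of representatives of that class.\<close>

definition gamma ::
  "('o, 'a) category \<Rightarrow> ('p \<Rightarrow> 'o) \<Rightarrow> ('b \<Rightarrow> 'a) \<Rightarrow> 'a set \<Rightarrow> 'p \<Rightarrow> 'b set \<Rightarrow> 'a set" where
  "gamma C Fo Fa M X c = sub_iso C M (Fo X) `` (Fa ` c)"

definition delta ::
  "('p, 'b) category \<Rightarrow> ('o, 'a) category \<Rightarrow> ('p \<Rightarrow> 'o) \<Rightarrow> ('b \<Rightarrow> 'a) \<Rightarrow> 'p \<Rightarrow> 'a set \<Rightarrow> 'b set"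
  where
  "delta A C Fo Fa X d = {p \<in> Ini A C Fo Fa. Cod A p = X \<and> Fa p \<in> d}"


section \<open>Quasi-uniformities\<close>

text \<open>Order-preserving maps on \<open>subobj C M X\<close> are represented by extensional functions, so that equal maps
  are equal as HOL functions.\<close>

definition sub_maps :: "('o, 'a) category \<Rightarrow> 'a set \<Rightarrow> 'o \<Rightarrow> ('a set \<Rightarrow> 'a set) set" where
  "sub_maps C M X =
     {U \<in> carrier (subobj C M X) \<rightarrow>\<^sub>E carrier (subobj C M X). isotone (subobj C M X) (subobj C M X) U}"

definition map_le ::
  "('o, 'a) category \<Rightarrow> 'a set \<Rightarrow> 'o \<Rightarrow> ('a set \<Rightarrow> 'a set) \<Rightarrow> ('a set \<Rightarrow> 'a set) \<Rightarrow> bool" where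
  "map_le C M X U V \<longleftrightarrow> (\<forall>m\<in>carrier (subobj C M X). U m \<sqsubseteq>\<^bsub>subobj C M X\<^esub> V m)"

definition map_meet ::
  "('o, 'a) category \<Rightarrow> 'a set \<Rightarrow> 'o \<Rightarrow> ('a set \<Rightarrow> 'a set) \<Rightarrow> ('a set \<Rightarrow> 'a set)
    \<Rightarrow> ('a set \<Rightarrow> 'a set)" where
  "map_meet C M X U V = (\<lambda>m\<in>carrier (subobj C M X). U m \<sqinter>\<^bsub>subobj C M X\<^esub> V m)"

type_synonym ('o, 'a) sub_map_family = "'o \<Rightarrow> ('a set \<Rightarrow> 'a set) set"

locale qu_base =
  fixes C :: "('o, 'a) category" and E M :: "'a set" and B :: "('o, 'a) sub_map_family"
  assumes maps: "X \<in> Obj C \<Longrightarrow> B X \<subseteq> sub_maps C M X"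
    and U1: "\<lbrakk>X \<in> Obj C; U \<in> B X; m \<in> carrier (subobj C M X)\<rbrakk> \<Longrightarrow> m \<sqsubseteq>\<^bsub>subobj C M X\<^esub> U m"
    and U2: "\<lbrakk>X \<in> Obj C; U \<in> B X\<rbrakk>
      \<Longrightarrow> \<exists>U'\<in>B X. map_le C M X (compose (carrier (subobj C M X)) U' U') U"
    and U4: "\<lbrakk>X \<in> Obj C; U \<in> B X; U' \<in> B X\<rbrakk> \<Longrightarrow> map_meet C M X U U' \<in> B X"
    and U5: "\<lbrakk>f \<in> Hom C X Y; U \<in> B Y\<rbrakk>
      \<Longrightarrow> \<exists>U'\<in>B X. \<forall>m\<in>carrier (subobj C M X).
            sub_image C E M f (U' m) \<sqsubseteq>\<^bsub>subobj C M Y\<^esub> U (sub_image C E M f m)"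

locale quasi_uniformity = qu_base C E M \<U>
  for C :: "('o, 'a) category" and E M :: "'a set" and \<U> :: "('o, 'a) sub_map_family" +
  assumes U3: "\<lbrakk>X \<in> Obj C; U \<in> \<U> X; U' \<in> sub_maps C M X; map_le C M X U U'\<rbrakk> \<Longrightarrow> U' \<in> \<U> X"

definition generated ::
  "('o, 'a) category \<Rightarrow> 'a set \<Rightarrow> ('o, 'a) sub_map_family \<Rightarrow> ('o, 'a) sub_map_family" where
  "generated C M B X = {V \<in> sub_maps C M X. \<exists>U\<in>B X. map_le C M X U V}"

definition transitive_base ::
  "('o, 'a) category \<Rightarrow> 'a set \<Rightarrow> ('o, 'a) sub_map_family \<Rightarrow> bool" where
  "transitive_base C M B \<longleftrightarrow>
     (\<forall>X\<in>Obj C. \<forall>U\<in>B X. compose (carrier (subobj C M X)) U U = U)"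

definition qu_le ::
  "('o, 'a) category \<Rightarrow> 'a set \<Rightarrow> ('o, 'a) sub_map_family \<Rightarrow> ('o, 'a) sub_map_family \<Rightarrow> bool" where
  "qu_le C M \<U> \<V> \<longleftrightarrow> (\<forall>X\<in>Obj C. \<forall>U\<in>\<U> X. \<exists>V\<in>\<V> X. map_le C M X V U)"

definition qu_initial ::
  "('o, 'a) category \<Rightarrow> 'a set \<Rightarrow> 'a set \<Rightarrow> ('o, 'a) sub_map_family \<Rightarrow> 'a \<Rightarrow> bool" where
  "qu_initial C E M \<U> f \<longleftrightarrow>
     (\<forall>U\<in>\<U> (Dom C f). \<exists>U'\<in>\<U> (Cod C f). \<forall>p\<in>carrier (subobj C M (Dom C f)).
        sub_inv_image C f (U' (sub_image C E M f p)) \<sqsubseteq>\<^bsub>subobj C M (Dom C f)\<^esub> U p)"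

definition qu_continuous ::
  "('p, 'b) category \<Rightarrow> ('o, 'a) category \<Rightarrow> ('p \<Rightarrow> 'o) \<Rightarrow> ('b \<Rightarrow> 'a) \<Rightarrow> 'a set
    \<Rightarrow> ('p, 'b) sub_map_family \<Rightarrow> ('o, 'a) sub_map_family \<Rightarrow> bool" where
  "qu_continuous A C Fo Fa M \<W> \<U> \<longleftrightarrow>
     (\<forall>X\<in>Obj A. \<forall>U\<in>\<U> (Fo X). \<exists>W\<in>\<W> X.
        \<forall>m\<in>carrier (subobj A (lift_M A C Fo Fa M) X).
          gamma C Fo Fa M X (W m) \<sqsubseteq>\<^bsub>subobj C M (Fo X)\<^esub> U (gamma C Fo Fa M X m))"

definition lift_base ::
  "('p, 'b) category \<Rightarrow> ('o, 'a) category \<Rightarrow> ('p \<Rightarrow> 'o) \<Rightarrow> ('b \<Rightarrow> 'a) \<Rightarrow> 'a set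
    \<Rightarrow> ('o, 'a) sub_map_family \<Rightarrow> ('p, 'b) sub_map_family" where
  "lift_base A C Fo Fa M B X =
     {\<lambda>m\<in>carrier (subobj A (lift_M A C Fo Fa M) X).
        delta A C Fo Fa X (U (gamma C Fo Fa M X m)) | U. U \<in> B (Fo X)}"

end

theory Submission
  imports Defs
begin

text \<open>For \<open>F\<close>-initial \<open>p\<close>, a morphism \<open>g\<close> into the codomain of \<open>p\<close> factors through \<open>p\<close> iff \<open>F g\<close> factors
  through \<open>F p\<close>. Hence factorizations, pullbacks and intersections lift along \<open>F\<close>, and \<open>\<gamma>\<close>, \<open>\<delta>\<close> are
  mutually inverse order isomorphisms that commute with images, inverse images and meets. The map
  \<open>\<delta> \<circ> U \<circ> \<gamma>\<close> is the conjugate of \<open>U\<close> under this isomorphism, so every axiom transfers; it is also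
  the largest \<open>W\<close> with \<open>\<gamma> \<circ> W \<le> U \<circ> \<gamma>\<close>, which gives minimality.\<close>

text \<open>Subobjects are whole isomorphism classes, and images and inverse images are sets of all
  admissible morphisms, so each computation must be shown independent of representatives.
  Isomorphism is therefore replaced by mutual factorization of \<open>M\<close>-morphisms, the
  relation that \<open>F\<close> preserves and, on F-initial morphisms, reflects. A factorization of
  \<open>F f\<close> lifts because its \<open>M\<close>-part ends at an object in the image of
  \<open>F\<close> and so has an initial lifting; the \<open>E\<close>-part then lifts by
  initiality, and so do diagonals. Faithfulness settles uniqueness and the remaining commutativity.
  After that \<open>A\<close> satisfies the same locale as \<open>C\<close>, so all results on
  representatives hold on both sides. Two points need extra care. The set
  \<open>sub_inv_image\<close> does not mention \<open>M\<close>, so pullbacks must first be shown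
  to lie in \<open>M\<close>. And \<open>U4\<close> asks that the meet itself belong to the base, so
  conjugation has to commute with meets on the nose; this rests on binary intersections.\<close>

context category
begin

section \<open>Factoring one morphism through another\<close>

lemma Hom_Arr: "f \<in> Hom C X Y \<Longrightarrow> f \<in> Arr C"
  and Hom_Dom: "f \<in> Hom C X Y \<Longrightarrow> Dom C f = X"
  and Hom_Cod: "f \<in> Hom C X Y \<Longrightarrow> Cod C f = Y"
  by (auto simp: Hom_def)

lemma Arr_Hom: "f \<in> Arr C \<Longrightarrow> f \<in> Hom C (Dom C f) (Cod C f)"
  by (auto simp: Hom_def)

lemma factors_throughI:
  "\<lbrakk>j \<in> Hom C X Y; m \<in> Hom C Y Z; m \<cdot> j = g\<rbrakk> \<Longrightarrow> factors_through C g m"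
  using Comp_in_Hom[of j X Y m Z] by (auto simp: factors_through_def Hom_def)

lemma factors_through_refl: "m \<in> Arr C \<Longrightarrow> factors_through C m m"
  using Comp_Ident[OF Arr_Hom] Ident_in_Hom[OF Dom_in_Obj] by (auto simp: factors_through_def)

lemma factors_through_trans:
  assumes "factors_through C g m" "factors_through C m n" "n \<in> Arr C"
  shows "factors_through C g n"
proof -
  from assms obtain j k where j: "j \<in> Hom C (Dom C g) (Dom C m)" "m \<cdot> j = g"
    and k: "k \<in> Hom C (Dom C m) (Dom C n)" "n \<cdot> k = m"
    by (auto simp: factors_through_def)
  have "n \<cdot> (k \<cdot> j) = g"
    using Comp_assoc[OF j(1) k(1) Arr_Hom[OF assms(3)]] j(2) k(2) by simp
  then show ?thesis
    using Comp_in_Hom[OF j(1) k(1)] by (auto simp: factors_through_def)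
qed

lemma mono_cancel:
  "\<lbrakk>is_mono C m; g \<in> Hom C Z (Dom C m); h \<in> Hom C Z (Dom C m); m \<cdot> g = m \<cdot> h\<rbrakk> \<Longrightarrow> g = h"
  by (auto simp: is_mono_def)

lemma isoI:
  "\<lbrakk>j \<in> Hom C X Y; k \<in> Hom C Y X; k \<cdot> j = Ident C X; j \<cdot> k = Ident C Y\<rbrakk> \<Longrightarrow> is_iso C j"
  by (auto simp: is_iso_def Hom_def)

text \<open>Both sides agree after composing with \<open>m\<close>, since m \<cdot> (j \<cdot> k) =
  n \<cdot> k = m. The statement is one-sided because \<open>pullback_in_M\<close> applies it when
  only one of the two morphisms is known to be monic.\<close>

lemma mono_split_iso:
  assumes m: "is_mono C m" and n: "n \<in> Arr C"
    and j: "j \<in> Hom C (Dom C n) (Dom C m)" "m \<cdot> j = n"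
    and k: "k \<in> Hom C (Dom C m) (Dom C n)" "n \<cdot> k = m"
  shows "j \<cdot> k = Ident C (Dom C m)"
proof (rule mono_cancel[OF m])
  have mH: "m \<in> Hom C (Dom C m) (Cod C m)" using m by (auto simp: is_mono_def Hom_def)
  then show "Ident C (Dom C m) \<in> Hom C (Dom C m) (Dom C m)"
    by (metis Dom_in_Obj Hom_Arr Ident_in_Hom)
  show "j \<cdot> k \<in> Hom C (Dom C m) (Dom C m)" using Comp_in_Hom j k by blast
  show "m \<cdot> (j \<cdot> k) = m \<cdot> Ident C (Dom C m)"
    using Comp_assoc[OF k(1) j(1) mH] Comp_Ident[OF mH] j(2) k(2) by simp
qed

end


section \<open>Subobjects represented by morphisms\<close>

text \<open>Every element of \<open>carrier (subobj C M X)\<close> has this form. The object is read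
  off as the codomain of the representative, so it need not be carried as an argument.\<close>

definition sub_class :: "('o, 'a) category \<Rightarrow> 'a set \<Rightarrow> 'a \<Rightarrow> 'a set" where
  "sub_class C M m = sub_iso C M (Cod C m) `` {m}"

context proper_factorization_system
begin

lemma M_Arr: "m \<in> M \<Longrightarrow> m \<in> Arr C"
  using M_mono by (auto simp: is_mono_def)

lemma E_Arr: "e \<in> E \<Longrightarrow> e \<in> Arr C"
  using E_epi by (auto simp: is_epi_def)

text \<open>The reverse factorization supplies the inverse of \<open>j\<close>: each of the two
  composites is an identity by \<open>mono_split_iso\<close>, once for each of the two
  monomorphisms.\<close>

lemma M_factors_iso:
  assumes "m \<in> M" "n \<in> M" "j \<in> Hom C (Dom C m) (Dom C n)" "n \<cdot> j = m" "factors_through C n m"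
  shows "is_iso C j"
proof -
  from assms(5) obtain k where k: "k \<in> Hom C (Dom C n) (Dom C m)" "m \<cdot> k = n"
    by (auto simp: factors_through_def)
  show ?thesis
    using mono_split_iso[OF M_mono M_Arr, of n m] mono_split_iso[OF M_mono M_Arr, of m n]
      assms k isoI by metis
qed

lemma iso_factors:
  assumes "m \<in> Arr C" "n \<in> Arr C" "j \<in> Hom C (Dom C m) (Dom C n)" "is_iso C j" "n \<cdot> j = m"
  shows "factors_through C n m"
proof -
  from assms(3,4) obtain k where k: "k \<in> Hom C (Dom C n) (Dom C m)" "j \<cdot> k = Ident C (Dom C n)"
    by (auto simp: is_iso_def Hom_def)
  have "m \<cdot> k = n"
    using Comp_assoc[OF k(1) assms(3) Arr_Hom[OF assms(2)]] Comp_Ident[OF Arr_Hom[OF assms(2)]]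
      assms(5) k(2) by simp
  then show ?thesis using k(1) by (auto simp: factors_through_def)
qed

text \<open>Two \<open>M\<close>-morphisms are isomorphic over \<open>X\<close> exactly when they
  factor through each other. In this form isomorphism can be compared across \<open>F\<close>
  without ever lifting an isomorphism.\<close>

lemma sub_iso_iff:
  "(m, n) \<in> sub_iso C M X \<longleftrightarrow> m \<in> M \<and> n \<in> M \<and> Cod C m = X \<and> Cod C n = X \<and>
     factors_through C m n \<and> factors_through C n m"
proof
  assume "(m, n) \<in> sub_iso C M X"
  then obtain j where *: "m \<in> M" "n \<in> M" "Cod C m = X" "Cod C n = X"
      "j \<in> Hom C (Dom C m) (Dom C n)" "is_iso C j" "n \<cdot> j = m"
    by (auto simp: sub_iso_def)
  moreover from * have "factors_through C n m" by (blast intro: iso_factors M_Arr)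
  moreover from * have "factors_through C m n" by (auto simp: factors_through_def)
  ultimately show "m \<in> M \<and> n \<in> M \<and> Cod C m = X \<and> Cod C n = X \<and>
     factors_through C m n \<and> factors_through C n m" by blast
next
  assume *: "m \<in> M \<and> n \<in> M \<and> Cod C m = X \<and> Cod C n = X \<and>
     factors_through C m n \<and> factors_through C n m"
  then obtain j where "j \<in> Hom C (Dom C m) (Dom C n)" "n \<cdot> j = m"
    by (auto simp: factors_through_def)
  with * M_factors_iso show "(m, n) \<in> sub_iso C M X" unfolding sub_iso_def by blast
qed

lemma equiv_sub_iso: "equiv {m \<in> M. Cod C m = X} (sub_iso C M X)"
proof (rule equivI)
  show "sub_iso C M X \<subseteq> {m \<in> M. Cod C m = X} \<times> {m \<in> M. Cod C m = X}"
    by (auto simp: sub_iso_def)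
  show "refl_on {m \<in> M. Cod C m = X} (sub_iso C M X)"
    by (auto simp: refl_on_def sub_iso_iff M_Arr factors_through_refl)
  show "sym (sub_iso C M X)" by (auto simp: sym_def sub_iso_iff)
  show "trans (sub_iso C M X)"
    by (rule transI) (auto simp: sub_iso_iff intro: factors_through_trans M_Arr)
qed

lemma mem_sub_class_iff:
  "m \<in> M \<Longrightarrow> n \<in> sub_class C M m \<longleftrightarrow>
     n \<in> M \<and> Cod C n = Cod C m \<and> factors_through C m n \<and> factors_through C n m"
  by (auto simp: sub_class_def sub_iso_iff)

lemma carrier_subobj: "carrier (subobj C M X) = sub_class C M ` {m \<in> M. Cod C m = X}"
  by (auto simp: subobj_def quotient_def sub_class_def)

lemma sub_class_in_carrier: "\<lbrakk>m \<in> M; Cod C m = X\<rbrakk> \<Longrightarrow> sub_class C M m \<in> carrier (subobj C M X)"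
  by (auto simp: carrier_subobj)

lemma carrier_subobjE:
  assumes "c \<in> carrier (subobj C M X)"
  obtains m where "m \<in> M" "Cod C m = X" "c = sub_class C M m"
  using assms by (auto simp: carrier_subobj)

text \<open>The order on classes is existential in the representatives; transitivity of
  factorization absorbs any change of representative.\<close>

lemma sub_class_le_iff:
  assumes "m \<in> M" "n \<in> M"
  shows "sub_class C M m \<sqsubseteq>\<^bsub>subobj C M X\<^esub> sub_class C M n \<longleftrightarrow> factors_through C m n"
proof -
  have "sub_class C M m \<sqsubseteq>\<^bsub>subobj C M X\<^esub> sub_class C M n \<longleftrightarrow>
      (\<exists>m'\<in>sub_class C M m. \<exists>n'\<in>sub_class C M n. factors_through C m' n')"
    by (simp add: subobj_def)
  also have "\<dots> \<longleftrightarrow> factors_through C m n"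
    using assms mem_sub_class_iff factors_through_trans factors_through_refl M_Arr
    by (smt (verit, ccfv_threshold))
  finally show ?thesis .
qed

lemma sub_class_eq_iff:
  assumes "m \<in> M" "n \<in> M" "Cod C m = Cod C n"
  shows "sub_class C M m = sub_class C M n \<longleftrightarrow> factors_through C m n \<and> factors_through C n m"
proof -
  have "sub_class C M m = sub_class C M n \<longleftrightarrow> (m, n) \<in> sub_iso C M (Cod C n)"
    unfolding sub_class_def assms(3) by (rule eq_equiv_class_iff[OF equiv_sub_iso]) (use assms in auto)
  then show ?thesis using assms by (simp add: sub_iso_iff)
qed

lemma partial_order_subobj: "partial_order (subobj C M X)"
proof unfold_locales
  fix c d assume "c \<in> carrier (subobj C M X)" "d \<in> carrier (subobj C M X)"
    and le: "c \<sqsubseteq>\<^bsub>subobj C M X\<^esub> d" "d \<sqsubseteq>\<^bsub>subobj C M X\<^esub> c"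
  then obtain m n where "m \<in> M" "n \<in> M" "Cod C m = X" "Cod C n = X"
    "c = sub_class C M m" "d = sub_class C M n"
    by (metis carrier_subobjE)
  then have "c = d" using le by (simp add: sub_class_le_iff sub_class_eq_iff)
  then show "c .=\<^bsub>subobj C M X\<^esub> d" by (simp add: subobj_def)
next
  fix c d e assume "c \<in> carrier (subobj C M X)" "d \<in> carrier (subobj C M X)"
    "e \<in> carrier (subobj C M X)" and le: "c \<sqsubseteq>\<^bsub>subobj C M X\<^esub> d" "d \<sqsubseteq>\<^bsub>subobj C M X\<^esub> e"
  then obtain m n p where "m \<in> M" "n \<in> M" "p \<in> M"
    "c = sub_class C M m" "d = sub_class C M n" "e = sub_class C M p"
    by (metis carrier_subobjE)
  then show "c \<sqsubseteq>\<^bsub>subobj C M X\<^esub> e"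
    using le by (auto simp: sub_class_le_iff intro: factors_through_trans M_Arr)
next
  fix c assume "c \<in> carrier (subobj C M X)"
  then show "c \<sqsubseteq>\<^bsub>subobj C M X\<^esub> c"
    by (metis carrier_subobjE sub_class_le_iff factors_through_refl M_Arr)
qed (auto simp: subobj_def)

lemma subobj_trans:
  "\<lbrakk>c \<sqsubseteq>\<^bsub>subobj C M X\<^esub> d; d \<sqsubseteq>\<^bsub>subobj C M X\<^esub> e; c \<in> carrier (subobj C M X);
    d \<in> carrier (subobj C M X); e \<in> carrier (subobj C M X)\<rbrakk> \<Longrightarrow> c \<sqsubseteq>\<^bsub>subobj C M X\<^esub> e"
  using partial_order_subobj[of X] by (auto simp: partial_order_def intro: weak_partial_order.le_trans)

lemma subobj_refl: "c \<in> carrier (subobj C M X) \<Longrightarrow> c \<sqsubseteq>\<^bsub>subobj C M X\<^esub> c"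
  using partial_order_subobj[of X] by (auto simp: partial_order_def intro: weak_partial_order.le_refl)


section \<open>Images and inverse images on representatives\<close>

text \<open>If m = m' \<cdot> j, the square n' \<cdot> (e' \<cdot> j) = n \<cdot> e has a diagonal
  because \<open>e\<close> lies in \<open>E\<close> and \<open>n'\<close> in \<open>M\<close>; that
  diagonal factors \<open>n\<close> through \<open>n'\<close>. Used in both directions, this yields
  uniqueness of images up to isomorphism and independence of the representative.\<close>

lemma image_factors_through:
  assumes "f \<in> Arr C" "m \<in> M" "m' \<in> M" "Cod C m = Dom C f" "Cod C m' = Dom C f"
    and n: "n \<in> M" "e \<in> E" "Cod C e = Dom C n" "n \<cdot> e = f \<cdot> m"
    and n': "n' \<in> M" "e' \<in> E" "Cod C e' = Dom C n'" "n' \<cdot> e' = f \<cdot> m'"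
    and "factors_through C m m'"
  shows "factors_through C n n'"
proof -
  from assms obtain j where j: "j \<in> Hom C (Dom C m) (Dom C m')" "m' \<cdot> j = m"
    by (auto simp: factors_through_def)
  have f: "f \<in> Hom C (Dom C f) (Cod C f)" using assms by (simp add: Arr_Hom)
  have m: "m \<in> Hom C (Dom C m) (Dom C f)" "m' \<in> Hom C (Dom C m') (Dom C f)"
    using assms M_Arr Arr_Hom by metis+
  have e: "e \<in> Hom C (Dom C e) (Dom C n)" "e' \<in> Hom C (Dom C e') (Dom C n')"
    using n n' E_Arr Arr_Hom by metis+
  have nn: "n \<in> Hom C (Dom C n) (Cod C n)" "n' \<in> Hom C (Dom C n') (Cod C n')"
    using n n' M_Arr Arr_Hom by metis+
  \<comment> \<open>The assumptions fix neither the domains of \<open>e\<close> and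
    \<open>e'\<close> nor the codomains of \<open>n\<close> and \<open>n'\<close>; these are read
    off from the equal composites.\<close>
  have "n \<cdot> e \<in> Hom C (Dom C e) (Cod C n)" "f \<cdot> m \<in> Hom C (Dom C m) (Cod C f)"
       "n' \<cdot> e' \<in> Hom C (Dom C e') (Cod C n')" "f \<cdot> m' \<in> Hom C (Dom C m') (Cod C f)"
    using f m e nn Comp_in_Hom by blast+
  then have eq: "Dom C e = Dom C m" "Dom C e' = Dom C m'" "Cod C n = Cod C f" "Cod C n' = Cod C f"
    using n(4) n'(4) by (auto simp: Hom_def)
  have e'j: "e' \<cdot> j \<in> Hom C (Dom C e) (Dom C n')"
    using Comp_in_Hom[OF j(1)] e(2) eq by simp
  have "n' \<cdot> (e' \<cdot> j) = n \<cdot> e"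
    using Comp_assoc[OF j(1), of e' "Dom C n'" n' "Cod C n'"] Comp_assoc[OF j(1) m(2) f]
      e nn eq n n' j by simp
  then obtain d where "d \<in> Hom C (Cod C e) (Dom C n')" "n' \<cdot> d = n"
    using diagonalization[OF n(2) n'(1), of "e' \<cdot> j" n] e'j nn eq n(3) by metis
  then show ?thesis using n(3) by (auto simp: factors_through_def)
qed

text \<open>One factorization of one representative determines the whole image class. Any two
  \<open>M\<close>-parts factor through each other by \<open>image_factors_through\<close>;
  conversely, a morphism isomorphic to \<open>n\<close> is again an \<open>M\<close>-part, because
  the isomorphism can be moved into the \<open>E\<close>-part.\<close>

lemma sub_image_sub_class:
  assumes f: "f \<in> Arr C" and m: "m \<in> M" "Cod C m = Dom C f"
    and n: "n \<in> M" "e \<in> E" "Cod C e = Dom C n" "n \<cdot> e = f \<cdot> m"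
  shows "sub_image C E M f (sub_class C M m) = sub_class C M n" "Cod C n = Cod C f"
proof -
  have codn: "Cod C n' = Cod C f"
    if "n' \<in> M" "e' \<in> E" "Cod C e' = Dom C n'" "n' \<cdot> e' = f \<cdot> m'" "m' \<in> M" "Cod C m' = Dom C f"
    for n' e' m'
    using that f M_Arr E_Arr
      Comp_in_Hom[of e' "Dom C e'" "Dom C n'" n' "Cod C n'"]
      Comp_in_Hom[of m' "Dom C m'" "Dom C f" f "Cod C f"]
    by (auto simp: Hom_def)
  show cn: "Cod C n = Cod C f" using codn n m by blast
  show "sub_image C E M f (sub_class C M m) = sub_class C M n"
  proof (intro equalityI subsetI)
    fix n' assume "n' \<in> sub_image C E M f (sub_class C M m)"
    then obtain m' e' where *: "n' \<in> M" "m' \<in> sub_class C M m" "e' \<in> E"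
        "Cod C e' = Dom C n'" "n' \<cdot> e' = f \<cdot> m'"
      by (auto simp: sub_image_def)
    then have m': "m' \<in> M" "Cod C m' = Dom C f" "factors_through C m m'" "factors_through C m' m"
      using m by (auto simp: mem_sub_class_iff)
    have "factors_through C n n'"
      by (rule image_factors_through[OF f m(1) m'(1) m(2) m'(2) n *(1,3-5) m'(3)])
    moreover have "factors_through C n' n"
      by (rule image_factors_through[OF f m'(1) m(1) m'(2) m(2) *(1,3-5) n m'(4)])
    moreover have "Cod C n' = Cod C f" using codn * m' by blast
    ultimately show "n' \<in> sub_class C M n" using n cn * by (simp add: mem_sub_class_iff)
  next
    fix n' assume "n' \<in> sub_class C M n"
    then have n': "n' \<in> M" "Cod C n' = Cod C n" "factors_through C n n'" "factors_through C n' n"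
      using n by (auto simp: mem_sub_class_iff)
    then obtain l where l: "l \<in> Hom C (Dom C n) (Dom C n')" "n' \<cdot> l = n"
      by (auto simp: factors_through_def)
    have "is_iso C l" using M_factors_iso n' n l by blast
    then have "l \<cdot> e \<in> E" using E_iso_closed n l by (auto simp: Hom_def)
    moreover have eH: "e \<in> Hom C (Dom C e) (Dom C n)" using n E_Arr Arr_Hom by metis
    moreover have "n' \<cdot> (l \<cdot> e) = f \<cdot> m"
      using Comp_assoc[OF eH l(1) Arr_Hom[OF M_Arr[OF n'(1)]]] l(2) n(4) by simp
    moreover have "Cod C (l \<cdot> e) = Dom C n'" using Comp_in_Hom[OF eH l(1)] by (auto simp: Hom_def)
    moreover have "m \<in> sub_class C M m" using m M_Arr by (simp add: mem_sub_class_iff factors_through_refl)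
    ultimately show "n' \<in> sub_image C E M f (sub_class C M m)"
      using n'(1) unfolding sub_image_def by blast
  qed
qed

lemma sub_image_in_carrier:
  assumes f: "f \<in> Hom C X Y" and c: "c \<in> carrier (subobj C M X)"
  shows "sub_image C E M f c \<in> carrier (subobj C M Y)"
proof -
  obtain m where m: "m \<in> M" "Cod C m = X" "c = sub_class C M m"
    using c by (rule carrier_subobjE)
  have "f \<cdot> m \<in> Arr C"
    using Comp_in_Hom[OF _ f] Arr_Hom[OF M_Arr[OF m(1)]] m(2) by (auto simp: Hom_def)
  then obtain e n where "e \<in> E" "n \<in> M" "Cod C e = Dom C n" "n \<cdot> e = f \<cdot> m"
    using factorization by blast
  then have "sub_image C E M f c = sub_class C M n" "Cod C n = Y"
    using sub_image_sub_class[of f m n e] f m by (auto simp: Hom_def)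
  then show ?thesis using \<open>n \<in> M\<close> by (simp add: sub_class_in_carrier)
qed

text \<open>For monomorphisms, pullbacks and intersections are described by factorizability alone;
  this makes their invariance under isomorphism and their lifting along \<open>F\<close> immediate.\<close>

lemma M_pullback_iff:
  assumes f: "f \<in> Arr C" and n: "n \<in> M" "Cod C f = Cod C n" and p: "p \<in> M" "Cod C p = Dom C f"
  shows "(\<exists>q. is_pullback C f n p q) \<longleftrightarrow>
    (\<forall>g\<in>Arr C. Cod C g = Dom C f \<longrightarrow> (factors_through C g p \<longleftrightarrow> factors_through C (f \<cdot> g) n))"
    (is "?L \<longleftrightarrow> ?R")
proof -
  have fH: "f \<in> Hom C (Dom C f) (Cod C f)" using f by (rule Arr_Hom)
  have pH: "p \<in> Hom C (Dom C p) (Dom C f)" using p M_Arr Arr_Hom by metis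
  have nH: "n \<in> Hom C (Dom C n) (Cod C f)" using n M_Arr Arr_Hom by metis
  show ?thesis
  proof
    assume ?L
    then obtain q where q: "q \<in> Hom C (Dom C p) (Dom C n)" "f \<cdot> p = n \<cdot> q"
      and univ: "\<And>Z g h. \<lbrakk>g \<in> Hom C Z (Dom C f); h \<in> Hom C Z (Dom C n); f \<cdot> g = n \<cdot> h\<rbrakk>
        \<Longrightarrow> \<exists>k. k \<in> Hom C Z (Dom C p) \<and> p \<cdot> k = g \<and> q \<cdot> k = h"
      unfolding is_pullback_def by metis
    show ?R
    proof (intro ballI impI iffI)
      fix g assume g: "g \<in> Arr C" "Cod C g = Dom C f" and "factors_through C g p"
      then obtain k where k: "k \<in> Hom C (Dom C g) (Dom C p)" "p \<cdot> k = g"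
        by (auto simp: factors_through_def)
      have "n \<cdot> (q \<cdot> k) = f \<cdot> g"
        using Comp_assoc[OF k(1) q(1) nH] Comp_assoc[OF k(1) pH fH] q(2) k(2) by simp
      with Comp_in_Hom[OF k(1) q(1)] nH show "factors_through C (f \<cdot> g) n"
        by (rule factors_throughI)
    next
      fix g assume g: "g \<in> Arr C" "Cod C g = Dom C f" and ft: "factors_through C (f \<cdot> g) n"
      have gH: "g \<in> Hom C (Dom C g) (Dom C f)" using g Arr_Hom by metis
      from ft obtain h where "h \<in> Hom C (Dom C g) (Dom C n)" "n \<cdot> h = f \<cdot> g"
        using Hom_Dom[OF Comp_in_Hom[OF gH fH]] by (auto simp: factors_through_def)
      with univ[OF gH] obtain k where "k \<in> Hom C (Dom C g) (Dom C p)" "p \<cdot> k = g" by metis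
      then show "factors_through C g p" by (auto simp: factors_through_def)
    qed
  next
    assume R: ?R
    \<comment> \<open>The criterion tested at \<open>g = p\<close>, which factors through itself,
      produces the second projection \<open>q\<close>.\<close>
    then have "factors_through C (f \<cdot> p) n"
      using p M_Arr factors_through_refl by blast
    then obtain q where q: "q \<in> Hom C (Dom C p) (Dom C n)" "n \<cdot> q = f \<cdot> p"
      using Hom_Dom[OF Comp_in_Hom[OF pH fH]] by (auto simp: factors_through_def)
    have "\<exists>!k. k \<in> Hom C Z (Dom C p) \<and> p \<cdot> k = g \<and> q \<cdot> k = h"
      if g: "g \<in> Hom C Z (Dom C f)" and h: "h \<in> Hom C Z (Dom C n)" and eq: "f \<cdot> g = n \<cdot> h" for Z g h
    proof -
      have "factors_through C (f \<cdot> g) n" using factors_throughI[OF h nH] eq by simp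
      then have "factors_through C g p" using R g by (auto simp: Hom_def)
      then obtain k where k: "k \<in> Hom C Z (Dom C p)" "p \<cdot> k = g"
        using g by (auto simp: factors_through_def Hom_def)
      have "n \<cdot> (q \<cdot> k) = n \<cdot> h"
        using Comp_assoc[OF k(1) q(1) nH] Comp_assoc[OF k(1) pH fH] q(2) k(2) eq by simp
      then have "q \<cdot> k = h"
        using mono_cancel[OF M_mono[OF n(1)] Comp_in_Hom[OF k(1) q(1)] h] by blast
      moreover have "k' = k" if "k' \<in> Hom C Z (Dom C p)" "p \<cdot> k' = g" for k'
        using mono_cancel[OF M_mono[OF p(1)] that(1) k(1)] that(2) k(2) by simp
      ultimately show ?thesis using k by blast
    qed
    then have "is_pullback C f n p q"
      unfolding is_pullback_def using f n p M_Arr pH q by auto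
    then show ?L by blast
  qed
qed

lemma M_intersection_iff:
  assumes d: "d \<in> M" "Cod C d = X" and S: "S \<subseteq> {m \<in> M. Cod C m = X}"
  shows "is_intersection C X S d \<longleftrightarrow>
    (\<forall>g\<in>Arr C. Cod C g = X \<longrightarrow> (factors_through C g d \<longleftrightarrow> (\<forall>m\<in>S. factors_through C g m)))"
    (is "?L \<longleftrightarrow> ?R")
proof
  assume L: ?L
  show ?R
  proof (intro ballI impI iffI)
    fix g m assume "factors_through C g d" "m \<in> S"
    then show "factors_through C g m"
      using L S factors_through_trans M_Arr by (auto simp: is_intersection_def)
  next
    fix g assume "g \<in> Arr C" "Cod C g = X" "\<forall>m\<in>S. factors_through C g m"
    then show "factors_through C g d"
      using L Arr_Hom unfolding is_intersection_def factors_through_def by metis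
  qed
next
  assume R: ?R
  have "\<exists>!k. k \<in> Hom C Z (Dom C d) \<and> d \<cdot> k = g"
    if g: "g \<in> Hom C Z X" "\<forall>m\<in>S. factors_through C g m" for Z g
  proof -
    have "factors_through C g d" using R g by (auto simp: Hom_def)
    then obtain k where k: "k \<in> Hom C Z (Dom C d)" "d \<cdot> k = g"
      using g by (auto simp: factors_through_def Hom_def)
    moreover have "k' = k" if "k' \<in> Hom C Z (Dom C d)" "d \<cdot> k' = g" for k'
      using mono_cancel[OF M_mono[OF d(1)] that(1) k(1)] that(2) k(2) by simp
    ultimately show ?thesis by blast
  qed
  then show ?L
    using R d M_Arr factors_through_refl unfolding is_intersection_def by blast
qed

text \<open>\<open>M_complete\<close> only promises some pullback in \<open>M\<close>, whereas
  \<open>sub_inv_image\<close> collects all pullbacks of all representatives. Such a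
  \<open>p'\<close> differs from the given \<open>p\<close> by an isomorphism, and \<open>M\<close>
  is closed under composing with isomorphisms.\<close>

lemma pullback_in_M:
  assumes n: "n \<in> M" "is_pullback C f n p q" and n': "n' \<in> sub_class C M n" "is_pullback C f n' p' q'"
    and p: "p \<in> M"
  shows "p' \<in> M"
proof -
  have n'M: "n' \<in> M" "factors_through C n' n" "factors_through C n n'"
    using n n' by (auto simp: mem_sub_class_iff)
  have f: "f \<in> Hom C (Dom C f) (Cod C f)"
    and nH: "n \<in> Hom C (Dom C n) (Cod C f)" "n' \<in> Hom C (Dom C n') (Cod C f)"
    and pH: "p \<in> Hom C (Dom C p) (Dom C f)" "p' \<in> Hom C (Dom C p') (Dom C f)"
    and q: "q \<in> Hom C (Dom C p) (Dom C n)" "f \<cdot> p = n \<cdot> q"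
    and q': "q' \<in> Hom C (Dom C p') (Dom C n')" "f \<cdot> p' = n' \<cdot> q'"
    using n(2) n'(2) by (auto simp: is_pullback_def Hom_def)
  have univ: "\<exists>k. k \<in> Hom C Z (Dom C p) \<and> p \<cdot> k = g"
    if "g \<in> Hom C Z (Dom C f)" "h \<in> Hom C Z (Dom C n)" "f \<cdot> g = n \<cdot> h" for Z g h
    using n(2) that unfolding is_pullback_def by metis
  have univ': "\<exists>!k. k \<in> Hom C Z (Dom C p') \<and> p' \<cdot> k = g \<and> q' \<cdot> k = h"
    if "g \<in> Hom C Z (Dom C f)" "h \<in> Hom C Z (Dom C n')" "f \<cdot> g = n' \<cdot> h" for Z g h
    using n'(2) that unfolding is_pullback_def by metis
  obtain a where a: "a \<in> Hom C (Dom C n') (Dom C n)" "n \<cdot> a = n'"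
    using n'M by (auto simp: factors_through_def)
  obtain b where b: "b \<in> Hom C (Dom C n) (Dom C n')" "n' \<cdot> b = n"
    using n'M by (auto simp: factors_through_def)
  have "f \<cdot> p' = n \<cdot> (a \<cdot> q')" using Comp_assoc[OF q'(1) a(1) nH(1)] a q' by simp
  from univ[OF pH(2) Comp_in_Hom[OF q'(1) a(1)] this]
  obtain j where j: "j \<in> Hom C (Dom C p') (Dom C p)" "p \<cdot> j = p'" by blast
  have "f \<cdot> p = n' \<cdot> (b \<cdot> q)" using Comp_assoc[OF q(1) b(1) nH(2)] b q by simp
  from univ'[OF pH(1) Comp_in_Hom[OF q(1) b(1)] this]
  obtain k where k: "k \<in> Hom C (Dom C p) (Dom C p')" "p' \<cdot> k = p" by blast
  have jk: "j \<cdot> k = Ident C (Dom C p)"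
    using mono_split_iso[OF M_mono[OF p] _ j k] pH by (auto simp: Hom_def)
  have kjH: "k \<cdot> j \<in> Hom C (Dom C p') (Dom C p')" using Comp_in_Hom[OF j(1) k(1)] .
  have p'kj: "p' \<cdot> (k \<cdot> j) = p'" using Comp_assoc[OF j(1) k(1) pH(2)] j k by simp
  \<comment> \<open>As \<open>p'\<close> is not yet known to be monic, k \<cdot> j = id cannot be
    obtained by cancelling it. Instead k \<cdot> j and the identity are both mediating morphisms of
    the second pullback; agreement on \<open>q'\<close> comes from \<open>n'\<close> being
    monic.\<close>
  have "n' \<cdot> (q' \<cdot> (k \<cdot> j)) = n' \<cdot> q'"
    using Comp_assoc[OF kjH q'(1) nH(2)] Comp_assoc[OF kjH pH(2) f] p'kj q'(2) by simp
  then have q'kj: "q' \<cdot> (k \<cdot> j) = q'"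
    using mono_cancel[OF M_mono[OF n'M(1)] Comp_in_Hom[OF kjH q'(1)] q'(1)] by blast
  have idH: "Ident C (Dom C p') \<in> Hom C (Dom C p') (Dom C p')"
    by (rule Ident_in_Hom[OF Dom_in_Obj[OF Hom_Arr[OF pH(2)]]])
  have "k \<cdot> j = Ident C (Dom C p')"
    using univ'[OF pH(2) q'(1) q'(2)] kjH p'kj q'kj idH Comp_Ident[OF pH(2)] Comp_Ident[OF q'(1)]
    by metis
  then have "is_iso C j" using isoI[OF j(1) k(1)] jk by blast
  then show "p' \<in> M" using M_iso_closed[OF p] j by (auto simp: Hom_def)
qed

text \<open>By \<open>M_pullback_iff\<close>, being a pullback of \<open>n\<close> along
  \<open>f\<close> is a condition on which morphisms factor through \<open>p\<close>, and this
  condition is unchanged when \<open>n\<close> or \<open>p\<close> is replaced by an isomorphic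
  morphism.\<close>

lemma sub_inv_image_sub_class:
  assumes n: "n \<in> M" and p: "p \<in> M" and pb: "is_pullback C f n p q"
  shows "sub_inv_image C f (sub_class C M n) = sub_class C M p"
proof -
  have f: "f \<in> Arr C" "Cod C f = Cod C n" "Cod C p = Dom C f"
    using pb by (auto simp: is_pullback_def Hom_def)
  have *: "factors_through C g p \<longleftrightarrow> factors_through C (f \<cdot> g) n"
    if "g \<in> Arr C" "Cod C g = Dom C f" for g
    using M_pullback_iff[OF f(1) n f(2) p f(3)] pb that by blast
  show ?thesis
  proof (intro equalityI subsetI)
    fix p' assume "p' \<in> sub_inv_image C f (sub_class C M n)"
    then obtain n' q' where n': "n' \<in> sub_class C M n" and pb': "is_pullback C f n' p' q'"
      by (auto simp: sub_inv_image_def)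
    have n'M: "n' \<in> M" "Cod C n' = Cod C n" "factors_through C n' n" "factors_through C n n'"
      using n n' by (auto simp: mem_sub_class_iff)
    have p': "p' \<in> M" using pullback_in_M[OF n pb n' pb' p] .
    have cp': "Cod C p' = Dom C f" using pb' by (auto simp: is_pullback_def Hom_def)
    have **: "factors_through C g p' \<longleftrightarrow> factors_through C (f \<cdot> g) n'"
      if "g \<in> Arr C" "Cod C g = Dom C f" for g
      using M_pullback_iff[OF f(1) n'M(1) _ p' cp'] f n'M pb' that by metis
    have "factors_through C g p \<longleftrightarrow> factors_through C g p'"
      if "g \<in> Arr C" "Cod C g = Dom C f" for g
      using *[OF that] **[OF that] n'M factors_through_trans M_Arr n by blast
    \<comment> \<open>Evaluating the equivalence at \<open>g = p\<close> and at
      \<open>g = p'\<close> gives the two factorizations.\<close>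
    then show "p' \<in> sub_class C M p"
      using p p' cp' f M_Arr factors_through_refl by (metis mem_sub_class_iff)
  next
    fix p' assume "p' \<in> sub_class C M p"
    then have p': "p' \<in> M" "Cod C p' = Dom C f" "factors_through C p' p" "factors_through C p p'"
      using p f by (auto simp: mem_sub_class_iff)
    have "factors_through C g p' \<longleftrightarrow> factors_through C (f \<cdot> g) n"
      if "g \<in> Arr C" "Cod C g = Dom C f" for g
      using *[OF that] p' factors_through_trans M_Arr p by blast
    then have "\<exists>q. is_pullback C f n p' q" using M_pullback_iff[OF f(1) n f(2) p'(1,2)] by blast
    moreover have "n \<in> sub_class C M n" using n M_Arr by (simp add: mem_sub_class_iff factors_through_refl)
    ultimately show "p' \<in> sub_inv_image C f (sub_class C M n)"
      unfolding sub_inv_image_def by blast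
  qed
qed

end


section \<open>Quasi-uniformities generated by bases\<close>

locale complete_factorization_system = proper_factorization_system C E M
  for C :: "('o, 'a) category" (structure) and E M +
  assumes M_complete: "M_complete C M"
begin

section \<open>Completeness: inverse images and meets of subobjects\<close>

lemma ex_pullback:
  "\<lbrakk>f \<in> Arr C; n \<in> M; Cod C f = Cod C n\<rbrakk> \<Longrightarrow> \<exists>p\<in>M. \<exists>q. is_pullback C f n p q"
  using M_complete by (auto simp: M_complete_def)

lemma ex_intersection:
  "\<lbrakk>X \<in> Obj C; S \<subseteq> {m \<in> M. Cod C m = X}\<rbrakk> \<Longrightarrow> \<exists>d\<in>M. is_intersection C X S d"
  using M_complete by (auto simp: M_complete_def)

lemma sub_inv_image_in_carrier:
  assumes f: "f \<in> Hom C X Y" and c: "c \<in> carrier (subobj C M Y)"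
  shows "sub_inv_image C f c \<in> carrier (subobj C M X)"
proof -
  obtain n where n: "n \<in> M" "Cod C n = Y" "c = sub_class C M n"
    using c by (rule carrier_subobjE)
  then obtain p q where "p \<in> M" "is_pullback C f n p q"
    using ex_pullback[of f n] f by (auto simp: Hom_def)
  then show ?thesis
    using sub_inv_image_sub_class[of n p f q] n f sub_class_in_carrier[of p X]
    by (auto simp: is_pullback_def Hom_def)
qed

text \<open>The intersection of a two-element family represents the greatest lower bound. Existence
  has to be settled before meets are used, since the meet operation is obtained by choice among
  greatest lower bounds.\<close>

lemma lower_semilattice_subobj:
  assumes X: "X \<in> Obj C"
  shows "lower_semilattice (subobj C M X)"
proof -
  interpret partial_order "subobj C M X" by (rule partial_order_subobj)
  show ?thesis
  proof unfold_locales
    fix x y assume "x \<in> carrier (subobj C M X)" "y \<in> carrier (subobj C M X)"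
    then obtain m n where m: "m \<in> M" "Cod C m = X" "x = sub_class C M m"
      and n: "n \<in> M" "Cod C n = X" "y = sub_class C M n"
      by (metis carrier_subobjE)
    have S: "{m, n} \<subseteq> {m \<in> M. Cod C m = X}" using m n by blast
    then obtain d where d: "d \<in> M" "is_intersection C X {m, n} d"
      using ex_intersection X by blast
    have cd: "Cod C d = X" using d by (simp add: is_intersection_def)
    have *: "factors_through C g d \<longleftrightarrow> factors_through C g m \<and> factors_through C g n"
      if "g \<in> Arr C" "Cod C g = X" for g
      using M_intersection_iff[OF d(1) cd S] d(2) that by auto
    have "is_glb (subobj C M X) (sub_class C M d) {x, y}"
      unfolding greatest_def Lower_def
      using *[of d] d cd m n * M_Arr factors_through_refl
      by (auto simp: sub_class_in_carrier sub_class_le_iff elim!: carrier_subobjE)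
    then show "\<exists>s. is_glb (subobj C M X) s {x, y}" by blast
  qed
qed

lemma map_meet_in_sub_maps:
  assumes X: "X \<in> Obj C" and U: "U \<in> sub_maps C M X" and V: "V \<in> sub_maps C M X"
  shows "map_meet C M X U V \<in> sub_maps C M X"
proof -
  interpret lower_semilattice "subobj C M X" using X by (rule lower_semilattice_subobj)
  have in_carrier: "U c \<in> carrier (subobj C M X)" "V c \<in> carrier (subobj C M X)"
    if "c \<in> carrier (subobj C M X)" for c
    using U V that by (auto simp: sub_maps_def PiE_iff)
  have mono: "U c \<sqsubseteq>\<^bsub>subobj C M X\<^esub> U d" "V c \<sqsubseteq>\<^bsub>subobj C M X\<^esub> V d"
    if "c \<in> carrier (subobj C M X)" "d \<in> carrier (subobj C M X)" "c \<sqsubseteq>\<^bsub>subobj C M X\<^esub> d" for c d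
    using U V that by (auto simp: sub_maps_def isotone_def)
  have "U c \<sqinter>\<^bsub>subobj C M X\<^esub> V c \<sqsubseteq>\<^bsub>subobj C M X\<^esub> U d \<sqinter>\<^bsub>subobj C M X\<^esub> V d"
    if "c \<in> carrier (subobj C M X)" "d \<in> carrier (subobj C M X)" "c \<sqsubseteq>\<^bsub>subobj C M X\<^esub> d" for c d
    by (intro meet_le in_carrier meet_closed le_trans[OF meet_left mono(1)]
        le_trans[OF meet_right mono(2)] that)
  then show ?thesis
    unfolding sub_maps_def map_meet_def isotone_def
    using in_carrier weak_partial_order_axioms by auto
qed

lemma map_meet_mono:
  assumes X: "X \<in> Obj C"
    and maps: "U \<in> sub_maps C M X" "U' \<in> sub_maps C M X" "V \<in> sub_maps C M X" "V' \<in> sub_maps C M X"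
    and le: "map_le C M X U V" "map_le C M X U' V'"
  shows "map_le C M X (map_meet C M X U U') (map_meet C M X V V')"
  unfolding map_le_def
proof
  interpret lower_semilattice "subobj C M X" using X by (rule lower_semilattice_subobj)
  fix c assume c: "c \<in> carrier (subobj C M X)"
  then have *: "U c \<in> carrier (subobj C M X)" "U' c \<in> carrier (subobj C M X)"
    "V c \<in> carrier (subobj C M X)" "V' c \<in> carrier (subobj C M X)"
    using maps by (auto simp: sub_maps_def PiE_iff)
  moreover have "U c \<sqsubseteq>\<^bsub>subobj C M X\<^esub> V c" "U' c \<sqsubseteq>\<^bsub>subobj C M X\<^esub> V' c"
    using le c by (auto simp: map_le_def)
  ultimately have "U c \<sqinter>\<^bsub>subobj C M X\<^esub> U' c \<sqsubseteq>\<^bsub>subobj C M X\<^esub> V c \<sqinter>\<^bsub>subobj C M X\<^esub> V' c"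
    by (intro meet_le meet_closed * le_trans[OF meet_left] le_trans[OF meet_right])
  then show "map_meet C M X U U' c \<sqsubseteq>\<^bsub>subobj C M X\<^esub> map_meet C M X V V' c"
    using c by (simp add: map_meet_def)
qed

section \<open>From a base to the quasi-uniformity it generates\<close>

lemma map_le_trans:
  assumes "U \<in> sub_maps C M X" "V \<in> sub_maps C M X" "W \<in> sub_maps C M X"
    and "map_le C M X U V" "map_le C M X V W"
  shows "map_le C M X U W"
  using assms unfolding map_le_def sub_maps_def
  by (auto simp: PiE_iff intro: subobj_trans)

lemma map_le_refl: "U \<in> sub_maps C M X \<Longrightarrow> map_le C M X U U"
  by (auto simp: map_le_def sub_maps_def PiE_iff intro: subobj_refl)

lemma base_subset_generated:
  "\<lbrakk>qu_base C E M B; X \<in> Obj C; U \<in> B X\<rbrakk> \<Longrightarrow> U \<in> generated C M B X"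
  using qu_base.maps[of C E M B X] map_le_refl by (auto simp: generated_def)

text \<open>Each axiom for \<open>V\<close> is inherited from a base member \<open>U\<close> below
  it. The witnesses for \<open>U2\<close> and \<open>U5\<close> are those of \<open>U\<close>, taken
  in the base itself; \<open>U4\<close> holds because the meet is monotone in both
  arguments.\<close>

lemma quasi_uniformity_generated:
  assumes B: "qu_base C E M B"
  shows "quasi_uniformity C E M (generated C M B)"
proof unfold_locales
  interpret B: qu_base C E M B by (rule B)
  have BM: "U \<in> sub_maps C M X" if "X \<in> Obj C" "U \<in> B X" for U X
    using B.maps that by blast
  have GM: "U \<in> sub_maps C M X" if "U \<in> generated C M B X" for U X
    using that by (simp add: generated_def)
  have car: "U c \<in> carrier (subobj C M X)" if "U \<in> sub_maps C M X" "c \<in> carrier (subobj C M X)" for U X c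
    using that by (auto simp: sub_maps_def PiE_iff)
  fix X assume X: "X \<in> Obj C"
  show "generated C M B X \<subseteq> sub_maps C M X" by (auto simp: generated_def)
  fix V assume V: "V \<in> generated C M B X"
  then obtain U where U: "U \<in> B X" "map_le C M X U V" by (auto simp: generated_def)
  note UM = BM[OF X U(1)] and VM = GM[OF V]
  have UV: "U c \<sqsubseteq>\<^bsub>subobj C M X\<^esub> V c" if "c \<in> carrier (subobj C M X)" for c
    using U(2) that by (simp add: map_le_def)
  show "c \<sqsubseteq>\<^bsub>subobj C M X\<^esub> V c" if c: "c \<in> carrier (subobj C M X)" for c
    by (rule subobj_trans[OF B.U1[OF X U(1) c] UV[OF c] c car[OF UM c] car[OF VM c]])
  obtain U' where U': "U' \<in> B X" "map_le C M X (compose (carrier (subobj C M X)) U' U') U"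
    using B.U2[OF X U(1)] by blast
  note U'M = BM[OF X U'(1)]
  have "map_le C M X (compose (carrier (subobj C M X)) U' U') V"
    unfolding map_le_def
  proof
    fix c assume c: "c \<in> carrier (subobj C M X)"
    have "U' (U' c) \<sqsubseteq>\<^bsub>subobj C M X\<^esub> U c"
      using U'(2) c by (simp add: map_le_def compose_eq)
    then have "U' (U' c) \<sqsubseteq>\<^bsub>subobj C M X\<^esub> V c"
      by (rule subobj_trans[OF _ UV[OF c] car[OF U'M car[OF U'M c]] car[OF UM c] car[OF VM c]])
    then show "compose (carrier (subobj C M X)) U' U' c \<sqsubseteq>\<^bsub>subobj C M X\<^esub> V c"
      using c by (simp add: compose_eq)
  qed
  then show "\<exists>U'\<in>generated C M B X. map_le C M X (compose (carrier (subobj C M X)) U' U') V"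
    using base_subset_generated[OF B X U'(1)] by blast
  fix V'
  {
    assume V': "V' \<in> generated C M B X"
    then obtain U' where U': "U' \<in> B X" "map_le C M X U' V'" by (auto simp: generated_def)
    have "map_le C M X (map_meet C M X U U') (map_meet C M X V V')"
      by (rule map_meet_mono[OF X UM BM[OF X U'(1)] VM GM[OF V'] U(2) U'(2)])
    then show "map_meet C M X V V' \<in> generated C M B X"
      using B.U4[OF X U(1) U'(1)] map_meet_in_sub_maps[OF X VM GM[OF V']]
      by (auto simp: generated_def)
  next
    assume "V' \<in> sub_maps C M X" "map_le C M X V V'"
    then show "V' \<in> generated C M B X"
      using map_le_trans[OF UM VM _ U(2)] U(1) by (auto simp: generated_def)
  }
next
  interpret B: qu_base C E M B by (rule B)
  fix f X Y V assume f: "f \<in> Hom C X Y" and V: "V \<in> generated C M B Y"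
  have X: "X \<in> Obj C" and Y: "Y \<in> Obj C" using f Dom_in_Obj Cod_in_Obj by (auto simp: Hom_def)
  obtain U where U: "U \<in> B Y" "map_le C M Y U V" using V by (auto simp: generated_def)
  obtain U' where U': "U' \<in> B X" "\<forall>m\<in>carrier (subobj C M X).
      sub_image C E M f (U' m) \<sqsubseteq>\<^bsub>subobj C M Y\<^esub> U (sub_image C E M f m)"
    using B.U5[OF f U(1)] by blast
  have "sub_image C E M f (U' m) \<sqsubseteq>\<^bsub>subobj C M Y\<^esub> V (sub_image C E M f m)"
    if m: "m \<in> carrier (subobj C M X)" for m
  proof -
    have fm: "sub_image C E M f m \<in> carrier (subobj C M Y)" using sub_image_in_carrier[OF f m] .
    have "U' m \<in> carrier (subobj C M X)"
      using B.maps[OF X] U' m by (auto simp: sub_maps_def PiE_iff)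
    then have fU: "sub_image C E M f (U' m) \<in> carrier (subobj C M Y)"
      by (rule sub_image_in_carrier[OF f])
    have "U (sub_image C E M f m) \<in> carrier (subobj C M Y)" "V (sub_image C E M f m) \<in> carrier (subobj C M Y)"
      using B.maps[OF Y] U V fm by (auto simp: sub_maps_def PiE_iff generated_def)
    moreover have "U (sub_image C E M f m) \<sqsubseteq>\<^bsub>subobj C M Y\<^esub> V (sub_image C E M f m)"
      using U(2) fm by (auto simp: map_le_def)
    ultimately show ?thesis using subobj_trans[OF U'(2)[rule_format, OF m]] fU by blast
  qed
  then show "\<exists>U'\<in>generated C M B X. \<forall>m\<in>carrier (subobj C M X).
      sub_image C E M f (U' m) \<sqsubseteq>\<^bsub>subobj C M Y\<^esub> V (sub_image C E M f m)"
    using base_subset_generated[OF B X U'(1)] by blast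
qed

end


section \<open>Lifting along an \<open>M\<close>-fibration\<close>

context cat_functor
begin

section \<open>What functors preserve and faithful functors reflect\<close>

lemma Fa_Arr: "f \<in> Arr A \<Longrightarrow> Fa f \<in> Arr C"
  and Dom_Fa: "f \<in> Arr A \<Longrightarrow> Dom C (Fa f) = Fo (Dom A f)"
  and Cod_Fa: "f \<in> Arr A \<Longrightarrow> Cod C (Fa f) = Fo (Cod A f)"
  using Fa_in_Hom[OF A.Arr_Hom] by (auto simp: Hom_def)

lemma Fa_iso:
  assumes "is_iso A j"
  shows "is_iso C (Fa j)"
proof -
  from assms obtain k where j: "j \<in> Hom A (Dom A j) (Cod A j)"
    and k: "k \<in> Hom A (Cod A j) (Dom A j)"
    and "k \<cdot>\<^bsub>A\<^esub> j = Ident A (Dom A j)" "j \<cdot>\<^bsub>A\<^esub> k = Ident A (Cod A j)"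
    by (auto simp: is_iso_def Hom_def)
  then have "Fa k \<cdot>\<^bsub>C\<^esub> Fa j = Ident C (Fo (Dom A j))" "Fa j \<cdot>\<^bsub>C\<^esub> Fa k = Ident C (Fo (Cod A j))"
    using Fa_Comp[OF j k] Fa_Comp[OF k j] Fa_Ident A.Dom_in_Obj A.Cod_in_Obj A.Hom_Arr by metis+
  then show ?thesis by (rule C.isoI[OF Fa_in_Hom[OF j] Fa_in_Hom[OF k]])
qed

lemma Fa_factors_through:
  assumes "factors_through A g p" "g \<in> Arr A" "p \<in> Arr A"
  shows "factors_through C (Fa g) (Fa p)"
proof -
  from assms obtain j where j: "j \<in> Hom A (Dom A g) (Dom A p)" "p \<cdot>\<^bsub>A\<^esub> j = g"
    by (auto simp: factors_through_def)
  then show ?thesis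
    using C.factors_throughI[OF Fa_in_Hom[OF j(1)] Fa_in_Hom[OF A.Arr_Hom[OF assms(3)]]]
      Fa_Comp[OF j(1) A.Arr_Hom[OF assms(3)]] by simp
qed

end

context faithful_functor
begin

lemma reflects_mono:
  assumes "m \<in> Arr A" "is_mono C (Fa m)"
  shows "is_mono A m"
  unfolding is_mono_def
proof (intro conjI allI ballI impI)
  fix Z g h assume g: "g \<in> Hom A Z (Dom A m)" and h: "h \<in> Hom A Z (Dom A m)"
    and "m \<cdot>\<^bsub>A\<^esub> g = m \<cdot>\<^bsub>A\<^esub> h"
  then have "Fa m \<cdot>\<^bsub>C\<^esub> Fa g = Fa m \<cdot>\<^bsub>C\<^esub> Fa h"
    using Fa_Comp[OF _ A.Arr_Hom[OF assms(1)]] by metis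
  then have "Fa g = Fa h"
    using C.mono_cancel[OF assms(2)] Fa_in_Hom[OF g] Fa_in_Hom[OF h] Dom_Fa[OF assms(1)] by metis
  then show "g = h" using faithful g h by blast
qed (rule assms)

lemma reflects_epi:
  assumes "e \<in> Arr A" "is_epi C (Fa e)"
  shows "is_epi A e"
  unfolding is_epi_def
proof (intro conjI allI ballI impI)
  fix Z g h assume g: "g \<in> Hom A (Cod A e) Z" and h: "h \<in> Hom A (Cod A e) Z"
    and "g \<cdot>\<^bsub>A\<^esub> e = h \<cdot>\<^bsub>A\<^esub> e"
  then have "Fa g \<cdot>\<^bsub>C\<^esub> Fa e = Fa h \<cdot>\<^bsub>C\<^esub> Fa e"
    using Fa_Comp[OF A.Arr_Hom[OF assms(1)]] by metis
  then have "Fa g = Fa h"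
    using assms(2) Fa_in_Hom[OF g] Fa_in_Hom[OF h] Cod_Fa[OF assms(1)]
    unfolding is_epi_def by metis
  then show "g = h" using faithful g h by blast
qed (rule assms)

text \<open>The uniqueness clause of initiality is automatic: a lift is determined by its image
  under the faithful \<open>F\<close>.\<close>

lemma IniI:
  assumes "f \<in> Arr A"
    and "\<And>Z h u. \<lbrakk>Z \<in> Obj A; h \<in> Hom A Z (Cod A f); u \<in> Hom C (Fo Z) (Fo (Dom A f));
        Fa f \<cdot>\<^bsub>C\<^esub> u = Fa h\<rbrakk> \<Longrightarrow> \<exists>v\<in>Hom A Z (Dom A f). Fa v = u \<and> f \<cdot>\<^bsub>A\<^esub> v = h"
  shows "f \<in> Ini A C Fo Fa"
  unfolding Ini_def using assms faithful by blast

lemma IniE: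
  assumes "f \<in> Ini A C Fo Fa" "h \<in> Hom A Z (Cod A f)" "u \<in> Hom C (Fo Z) (Fo (Dom A f))"
    "Fa f \<cdot>\<^bsub>C\<^esub> u = Fa h"
  obtains v where "v \<in> Hom A Z (Dom A f)" "Fa v = u" "f \<cdot>\<^bsub>A\<^esub> v = h"
  using assms A.Dom_in_Obj[of h] unfolding Ini_def Hom_def by blast

text \<open>A mediating \<open>u\<close> below with F p \<cdot> u = F g is exactly the datum that
  initiality of \<open>p\<close> lifts.\<close>

lemma Ini_factors_through_iff:
  assumes p: "p \<in> Ini A C Fo Fa" and g: "g \<in> Arr A" "Cod A g = Cod A p"
  shows "factors_through A g p \<longleftrightarrow> factors_through C (Fa g) (Fa p)"
proof
  have pA: "p \<in> Arr A" using p by (simp add: Ini_def)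
  show "factors_through C (Fa g) (Fa p)" if "factors_through A g p"
    using Fa_factors_through that g pA by blast
  assume "factors_through C (Fa g) (Fa p)"
  then obtain u where u: "u \<in> Hom C (Fo (Dom A g)) (Fo (Dom A p))" "Fa p \<cdot>\<^bsub>C\<^esub> u = Fa g"
    using Dom_Fa g pA by (auto simp: factors_through_def)
  have "g \<in> Hom A (Dom A g) (Cod A p)" using g by (simp add: Hom_def)
  then obtain v where "v \<in> Hom A (Dom A g) (Dom A p)" "p \<cdot>\<^bsub>A\<^esub> v = g"
    using IniE[OF p _ u] by blast
  then show "factors_through A g p" by (auto simp: factors_through_def)
qed

text \<open>Lift F j \<cdot> u along \<open>m\<close>, then compose the lift with the inverse of
  \<open>j\<close>. This gives closure of \<open>M\<^sub>F\<close> under composition with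
  isomorphisms.\<close>

lemma Ini_Comp_iso:
  assumes m: "m \<in> Ini A C Fo Fa" and j: "is_iso A j" "Cod A j = Dom A m"
  shows "m \<cdot>\<^bsub>A\<^esub> j \<in> Ini A C Fo Fa"
proof -
  have mH: "m \<in> Hom A (Dom A m) (Cod A m)" using m by (simp add: Ini_def Hom_def)
  have jH: "j \<in> Hom A (Dom A j) (Dom A m)" using j by (simp add: is_iso_def Hom_def)
  obtain k where k: "k \<in> Hom A (Dom A m) (Dom A j)"
    "k \<cdot>\<^bsub>A\<^esub> j = Ident A (Dom A j)" "j \<cdot>\<^bsub>A\<^esub> k = Ident A (Dom A m)"
    using j by (auto simp: is_iso_def)
  note mj = A.Comp_in_Hom[OF jH mH]
  show ?thesis
  proof (rule IniI)
    show "m \<cdot>\<^bsub>A\<^esub> j \<in> Arr A" using mj by (rule A.Hom_Arr)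
    fix Z h u
    assume h: "h \<in> Hom A Z (Cod A (m \<cdot>\<^bsub>A\<^esub> j))" and u: "u \<in> Hom C (Fo Z) (Fo (Dom A (m \<cdot>\<^bsub>A\<^esub> j)))"
      and eq: "Fa (m \<cdot>\<^bsub>A\<^esub> j) \<cdot>\<^bsub>C\<^esub> u = Fa h"
    have h': "h \<in> Hom A Z (Cod A m)" and u': "u \<in> Hom C (Fo Z) (Fo (Dom A j))"
      using h u A.Hom_Cod[OF mj] A.Hom_Dom[OF mj] by simp_all
    have "Fa m \<cdot>\<^bsub>C\<^esub> (Fa j \<cdot>\<^bsub>C\<^esub> u) = Fa h"
      using eq C.Comp_assoc[OF u' Fa_in_Hom[OF jH] Fa_in_Hom[OF mH]] Fa_Comp[OF jH mH] by simp
    from IniE[OF m h' C.Comp_in_Hom[OF u' Fa_in_Hom[OF jH]] this]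
    obtain v where v: "v \<in> Hom A Z (Dom A m)" "Fa v = Fa j \<cdot>\<^bsub>C\<^esub> u" "m \<cdot>\<^bsub>A\<^esub> v = h" by blast
    have "Fa k \<cdot>\<^bsub>C\<^esub> Fa j = Ident C (Fo (Dom A j))"
      using Fa_Comp[OF jH k(1)] k(2) Fa_Ident A.Dom_in_Obj A.Hom_Arr[OF jH] by metis
    then have "Fa (k \<cdot>\<^bsub>A\<^esub> v) = u"
      using Fa_Comp[OF v(1) k(1)] C.Comp_assoc[OF u' Fa_in_Hom[OF jH] Fa_in_Hom[OF k(1)]]
        v(2) C.Ident_Comp[OF u'] by simp
    moreover have "(m \<cdot>\<^bsub>A\<^esub> j) \<cdot>\<^bsub>A\<^esub> (k \<cdot>\<^bsub>A\<^esub> v) = h"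
      using A.Comp_assoc[OF A.Comp_in_Hom[OF v(1) k(1)] jH mH] A.Comp_assoc[OF v(1) k(1) jH]
        k(3) A.Ident_Comp[OF v(1)] v(3) by simp
    moreover have "k \<cdot>\<^bsub>A\<^esub> v \<in> Hom A Z (Dom A (m \<cdot>\<^bsub>A\<^esub> j))"
      using A.Comp_in_Hom[OF v(1) k(1)] A.Hom_Dom[OF mj] by simp
    ultimately show "\<exists>v\<in>Hom A Z (Dom A (m \<cdot>\<^bsub>A\<^esub> j)). Fa v = u \<and> (m \<cdot>\<^bsub>A\<^esub> j) \<cdot>\<^bsub>A\<^esub> v = h" by blast
  qed
qed

end

section \<open>The lifted factorization system and its completeness\<close>

locale complete_fibration = M_fibration A C Fo Fa M + C: complete_factorization_system C E M
  for A :: "('p, 'b) category" and C :: "('o, 'a) category"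
    and Fo :: "'p \<Rightarrow> 'o" and Fa :: "'b \<Rightarrow> 'a" and E M :: "'a set"
begin

abbreviation "E\<^sub>F \<equiv> lift_E A Fa E"
abbreviation "M\<^sub>F \<equiv> lift_M A C Fo Fa M"

lemma M\<^sub>F_D: "m \<in> M\<^sub>F \<Longrightarrow> m \<in> Arr A" "m \<in> M\<^sub>F \<Longrightarrow> Fa m \<in> M" "m \<in> M\<^sub>F \<Longrightarrow> m \<in> Ini A C Fo Fa"
  by (auto simp: lift_M_def)

lemma M\<^sub>F_factors_iff:
  "\<lbrakk>p \<in> M\<^sub>F; g \<in> Arr A; Cod A g = Cod A p\<rbrakk>
    \<Longrightarrow> factors_through A g p \<longleftrightarrow> factors_through C (Fa g) (Fa p)"
  by (simp add: Ini_factors_through_iff M\<^sub>F_D)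

lemma M_lifting:
  assumes "X \<in> Obj A" "n \<in> M" "Cod C n = Fo X"
  obtains p where "p \<in> M\<^sub>F" "Cod A p = X" "Fa p = n"
  using initial_lifting[OF assms] assms(2) by (auto simp: lift_M_def Ini_def)

lemma lifted_factorization_system: "proper_factorization_system A E\<^sub>F M\<^sub>F"
proof unfold_locales
  show "is_epi A e" if "e \<in> E\<^sub>F" for e
    using that C.E_epi reflects_epi by (auto simp: lift_E_def)
  show "is_mono A m" if "m \<in> M\<^sub>F" for m
    using that C.M_mono reflects_mono M\<^sub>F_D by blast
next
  fix e j assume e: "e \<in> E\<^sub>F" and j: "is_iso A j" "Cod A e = Dom A j"
  have eH: "e \<in> Hom A (Dom A e) (Dom A j)" using e j by (simp add: lift_E_def Hom_def)
  have jH: "j \<in> Hom A (Dom A j) (Cod A j)" using j by (simp add: is_iso_def Hom_def)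
  have "Fa j \<cdot>\<^bsub>C\<^esub> Fa e \<in> E"
    using C.E_iso_closed[OF _ Fa_iso[OF j(1)]] e C.Hom_Cod[OF Fa_in_Hom[OF eH]]
      C.Hom_Dom[OF Fa_in_Hom[OF jH]] by (simp add: lift_E_def)
  then show "j \<cdot>\<^bsub>A\<^esub> e \<in> E\<^sub>F"
    using Fa_Comp[OF eH jH] A.Hom_Arr[OF A.Comp_in_Hom[OF eH jH]] by (simp add: lift_E_def)
next
  fix m j assume m: "m \<in> M\<^sub>F" and j: "is_iso A j" "Cod A j = Dom A m"
  have mH: "m \<in> Hom A (Dom A m) (Cod A m)" using M\<^sub>F_D(1)[OF m] by (simp add: Hom_def)
  have jH: "j \<in> Hom A (Dom A j) (Dom A m)" using j by (simp add: is_iso_def Hom_def)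
  have "Fa m \<cdot>\<^bsub>C\<^esub> Fa j \<in> M"
    using C.M_iso_closed[OF M\<^sub>F_D(2)[OF m] Fa_iso[OF j(1)]] C.Hom_Cod[OF Fa_in_Hom[OF jH]]
      C.Hom_Dom[OF Fa_in_Hom[OF mH]] by simp
  then show "m \<cdot>\<^bsub>A\<^esub> j \<in> M\<^sub>F"
    using Fa_Comp[OF jH mH] A.Hom_Arr[OF A.Comp_in_Hom[OF jH mH]] Ini_Comp_iso[OF M\<^sub>F_D(3)[OF m] j]
    by (simp add: lift_M_def)
next
  fix f assume f: "f \<in> Arr A"
  then obtain e m where e: "e \<in> E" and m: "m \<in> M" and em: "Cod C e = Dom C m" "m \<cdot>\<^bsub>C\<^esub> e = Fa f"
    using C.factorization Fa_Arr by blast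
  have eH: "e \<in> Hom C (Dom C e) (Dom C m)" using e em C.E_Arr C.Arr_Hom by metis
  note meH = C.Comp_in_Hom[OF eH C.Arr_Hom[OF C.M_Arr[OF m]]]
  have De: "Dom C e = Fo (Dom A f)" and Cm: "Cod C m = Fo (Cod A f)"
    using C.Hom_Dom[OF meH] C.Hom_Cod[OF meH] em Dom_Fa Cod_Fa f by auto
  \<comment> \<open>The \<open>M\<close>-part ends at F (Cod f), so it has an initial lifting
    \<open>p\<close>; initiality of \<open>p\<close> then turns \<open>e\<close> into a morphism of
    \<open>A\<close> starting at the domain of \<open>f\<close>.\<close>
  then obtain p where p: "p \<in> M\<^sub>F" "Cod A p = Cod A f" "Fa p = m"
    using M_lifting A.Cod_in_Obj f m by metis
  have "f \<in> Hom A (Dom A f) (Cod A p)" using f p by (simp add: Hom_def)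
  moreover have "e \<in> Hom C (Fo (Dom A f)) (Fo (Dom A p))"
    using eH De p Dom_Fa[OF M\<^sub>F_D(1)[OF p(1)]] by simp
  ultimately obtain v where v: "v \<in> Hom A (Dom A f) (Dom A p)" "Fa v = e" "p \<cdot>\<^bsub>A\<^esub> v = f"
    using IniE[OF M\<^sub>F_D(3)[OF p(1)]] p(3) em(2) by metis
  then have "v \<in> E\<^sub>F" using e by (simp add: lift_E_def Hom_def)
  moreover have "Cod A v = Dom A p" using v by (simp add: Hom_def)
  ultimately show "\<exists>e\<in>E\<^sub>F. \<exists>m\<in>M\<^sub>F. Cod A e = Dom A m \<and> m \<cdot>\<^bsub>A\<^esub> e = f" using p v by blast
next
  fix e m f g assume e: "e \<in> E\<^sub>F" and m: "m \<in> M\<^sub>F" and f: "f \<in> Hom A (Dom A e) (Dom A m)"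
    and g: "g \<in> Hom A (Cod A e) (Cod A m)" and eq: "m \<cdot>\<^bsub>A\<^esub> f = g \<cdot>\<^bsub>A\<^esub> e"
  have eH: "e \<in> Hom A (Dom A e) (Cod A e)" and eE: "Fa e \<in> E" using e by (auto simp: lift_E_def Hom_def)
  have mH: "m \<in> Hom A (Dom A m) (Cod A m)" using M\<^sub>F_D(1)[OF m] by (simp add: Hom_def)
  note ends = C.Hom_Dom[OF Fa_in_Hom[OF eH]] C.Hom_Cod[OF Fa_in_Hom[OF eH]]
    C.Hom_Dom[OF Fa_in_Hom[OF mH]] C.Hom_Cod[OF Fa_in_Hom[OF mH]]
  have "Fa m \<cdot>\<^bsub>C\<^esub> Fa f = Fa g \<cdot>\<^bsub>C\<^esub> Fa e" using Fa_Comp[OF f mH] Fa_Comp[OF eH g] eq by simp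
  then obtain d where d: "d \<in> Hom C (Fo (Cod A e)) (Fo (Dom A m))"
      "d \<cdot>\<^bsub>C\<^esub> Fa e = Fa f" "Fa m \<cdot>\<^bsub>C\<^esub> d = Fa g"
    using C.diagonalization[OF eE M\<^sub>F_D(2)[OF m], of "Fa f" "Fa g"] Fa_in_Hom[OF f] Fa_in_Hom[OF g] ends
    by auto
  \<comment> \<open>The diagonal found in \<open>C\<close> lifts along the initial \<open>m\<close>,
    which gives the lower triangle; the upper triangle follows from faithfulness.\<close>
  obtain v where v: "v \<in> Hom A (Cod A e) (Dom A m)" "Fa v = d" "m \<cdot>\<^bsub>A\<^esub> v = g"
    using IniE[OF M\<^sub>F_D(3)[OF m] g d(1,3)] by blast
  have "v \<cdot>\<^bsub>A\<^esub> e = f"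
    using faithful[OF A.Comp_in_Hom[OF eH v(1)] f] Fa_Comp[OF eH v(1)] v(2) d(2) by simp
  moreover have "v' = v" if "v' \<in> Hom A (Cod A e) (Dom A m)" "m \<cdot>\<^bsub>A\<^esub> v' = g" for v'
    using A.mono_cancel[OF reflects_mono[OF M\<^sub>F_D(1)[OF m] C.M_mono[OF M\<^sub>F_D(2)[OF m]]] that(1) v(1)]
      that(2) v(3) by simp
  ultimately show "\<exists>!d. d \<in> Hom A (Cod A e) (Dom A m) \<and> d \<cdot>\<^bsub>A\<^esub> e = f \<and> m \<cdot>\<^bsub>A\<^esub> d = g"
    using v by blast
qed

sublocale lifted: proper_factorization_system A E\<^sub>F M\<^sub>F
  by (rule lifted_factorization_system)

text \<open>The factorization criterion transfers through \<open>F\<close> because \<open>n\<close>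
  and \<open>p\<close> are both initial. The second projection in \<open>A\<close> is then delivered
  by \<open>M_pullback_iff\<close>, so \<open>q\<close> need not be lifted.\<close>

lemma lifted_pullback:
  assumes f: "f \<in> Arr A" and n: "n \<in> M\<^sub>F" and fn: "Cod A f = Cod A n"
    and p: "p \<in> M\<^sub>F" "Cod A p = Dom A f" and pb: "is_pullback C (Fa f) (Fa n) (Fa p) q"
  shows "\<exists>q. is_pullback A f n p q"
proof -
  have "factors_through A g p \<longleftrightarrow> factors_through A (f \<cdot>\<^bsub>A\<^esub> g) n"
    if g: "g \<in> Arr A" "Cod A g = Dom A f" for g
  proof -
    have gH: "g \<in> Hom A (Dom A g) (Dom A f)" using g by (simp add: Hom_def)
    note fgH = A.Comp_in_Hom[OF gH A.Arr_Hom[OF f]]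
    have "factors_through A g p \<longleftrightarrow> factors_through C (Fa g) (Fa p)"
      using M\<^sub>F_factors_iff p g by simp
    also have "\<dots> \<longleftrightarrow> factors_through C (Fa f \<cdot>\<^bsub>C\<^esub> Fa g) (Fa n)"
      using C.M_pullback_iff[of "Fa f" "Fa n" "Fa p"] pb f g n p fn M\<^sub>F_D Fa_Arr Dom_Fa Cod_Fa by metis
    also have "\<dots> \<longleftrightarrow> factors_through A (f \<cdot>\<^bsub>A\<^esub> g) n"
      using M\<^sub>F_factors_iff[OF n] A.Hom_Arr[OF fgH] A.Hom_Cod[OF fgH] fn
        Fa_Comp[OF gH A.Arr_Hom[OF f]] by simp
    finally show ?thesis .
  qed
  then show ?thesis using lifted.M_pullback_iff[OF f n fn p] by blast
qed

text \<open>A single \<open>p\<close> serves in \<open>A\<close> and, through its image, in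
  \<open>C\<close>. This simultaneous choice is what makes \<open>\<gamma>\<close> commute with
  inverse images.\<close>

lemma ex_lifted_pullback:
  assumes f: "f \<in> Arr A" and n: "n \<in> M\<^sub>F" and fn: "Cod A f = Cod A n"
  obtains p q q' where "p \<in> M\<^sub>F" "Cod A p = Dom A f" "is_pullback A f n p q"
    "is_pullback C (Fa f) (Fa n) (Fa p) q'"
proof -
  obtain p0 q' where p0: "p0 \<in> M" "is_pullback C (Fa f) (Fa n) p0 q'"
    using C.ex_pullback[of "Fa f" "Fa n"] f n fn M\<^sub>F_D Fa_Arr Cod_Fa by metis
  then have "Cod C p0 = Fo (Dom A f)" using Dom_Fa[OF f] by (simp add: is_pullback_def Hom_def)
  then obtain p where "p \<in> M\<^sub>F" "Cod A p = Dom A f" "Fa p = p0"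
    using M_lifting A.Dom_in_Obj f p0 by metis
  then show ?thesis using that lifted_pullback[OF f n fn] p0(2) by metis
qed

lemma ex_lifted_intersection:
  assumes X: "X \<in> Obj A" and S: "S \<subseteq> {m \<in> M\<^sub>F. Cod A m = X}"
  shows "\<exists>d\<in>M\<^sub>F. is_intersection A X S d"
proof -
  have FS: "Fa ` S \<subseteq> {m \<in> M. Cod C m = Fo X}" using S by (auto simp: M\<^sub>F_D Cod_Fa)
  then obtain d0 where d0: "d0 \<in> M" "is_intersection C (Fo X) (Fa ` S) d0"
    using C.ex_intersection Fo_in_Obj[OF X] by blast
  have cd0: "Cod C d0 = Fo X" using d0 by (simp add: is_intersection_def)
  obtain d where d: "d \<in> M\<^sub>F" "Cod A d = X" "Fa d = d0" using M_lifting[OF X d0(1) cd0] .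
  have "factors_through A g d \<longleftrightarrow> (\<forall>m\<in>S. factors_through A g m)"
    if g: "g \<in> Arr A" "Cod A g = X" for g
  proof -
    have "factors_through A g d \<longleftrightarrow> factors_through C (Fa g) d0"
      using M\<^sub>F_factors_iff d g by simp
    also have "\<dots> \<longleftrightarrow> (\<forall>m\<in>S. factors_through C (Fa g) (Fa m))"
      using C.M_intersection_iff[OF d0(1) cd0 FS] d0(2) Fa_Arr[OF g(1)] Cod_Fa[OF g(1)] g(2) by simp
    also have "\<dots> \<longleftrightarrow> (\<forall>m\<in>S. factors_through A g m)"
      using S by (intro ball_cong refl M\<^sub>F_factors_iff[symmetric]) (auto simp: g)
    finally show ?thesis .
  qed
  then show ?thesis using lifted.M_intersection_iff[OF d(1,2) S] d(1) by blast
qed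

sublocale lifted: complete_factorization_system A E\<^sub>F M\<^sub>F
proof unfold_locales
  have "\<exists>p\<in>M\<^sub>F. \<exists>q. is_pullback A f n p q" if "f \<in> Arr A" "n \<in> M\<^sub>F" "Cod A f = Cod A n" for f n
    using ex_lifted_pullback[OF that] by metis
  then show "M_complete A M\<^sub>F"
    unfolding M_complete_def using ex_lifted_intersection by blast
qed


section \<open>The order equivalence \<open>\<gamma>\<close>, \<open>\<delta>\<close>\<close>

abbreviation "\<gamma> \<equiv> gamma C Fo Fa M"
abbreviation "\<delta> \<equiv> delta A C Fo Fa"
abbreviation "subA \<equiv> subobj A M\<^sub>F"
abbreviation "subC X \<equiv> subobj C M (Fo X)"

text \<open>All members of the class contribute the same class below, so the relational image in
  \<open>gamma\<close> collapses to it.\<close>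

lemma gamma_sub_class:
  assumes m: "m \<in> M\<^sub>F" "Cod A m = X"
  shows "\<gamma> X (sub_class A M\<^sub>F m) = sub_class C M (Fa m)"
proof -
  have "m \<in> sub_class A M\<^sub>F m"
    using m M\<^sub>F_D by (simp add: lifted.mem_sub_class_iff A.factors_through_refl)
  moreover have "sub_iso C M (Fo X) `` {Fa m'} = sub_class C M (Fa m)" if "m' \<in> sub_class A M\<^sub>F m" for m'
  proof -
    have m': "m' \<in> M\<^sub>F" "Cod A m' = X" "factors_through A m m'" "factors_through A m' m"
      using that m by (simp_all add: lifted.mem_sub_class_iff)
    have "sub_class C M (Fa m') = sub_class C M (Fa m)"
      using C.sub_class_eq_iff[OF M\<^sub>F_D(2)[OF m'(1)] M\<^sub>F_D(2)[OF m(1)]]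
        Cod_Fa[OF M\<^sub>F_D(1)[OF m'(1)]] Cod_Fa[OF M\<^sub>F_D(1)[OF m(1)]] m m'
        Fa_factors_through[OF m'(3) M\<^sub>F_D(1)[OF m(1)] M\<^sub>F_D(1)[OF m'(1)]]
        Fa_factors_through[OF m'(4) M\<^sub>F_D(1)[OF m'(1)] M\<^sub>F_D(1)[OF m(1)]] by simp
    then show ?thesis using Cod_Fa[OF M\<^sub>F_D(1)[OF m'(1)]] m'(2) by (simp add: sub_class_def)
  qed
  ultimately show ?thesis unfolding gamma_def by blast
qed

text \<open>An initial \<open>p'\<close> whose image lies in a subobject class is automatically in
  \<open>M\<^sub>F\<close>, and for initial morphisms mutual factorization above and below are the
  same.\<close>

lemma delta_sub_class:
  assumes p: "p \<in> M\<^sub>F" "Cod A p = X"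
  shows "\<delta> X (sub_class C M (Fa p)) = sub_class A M\<^sub>F p"
proof -
  have "p' \<in> Ini A C Fo Fa \<and> Cod A p' = X \<and> Fa p' \<in> sub_class C M (Fa p) \<longleftrightarrow>
      p' \<in> sub_class A M\<^sub>F p" for p'
  proof -
    have "p' \<in> Ini A C Fo Fa \<and> Cod A p' = X \<and> Fa p' \<in> sub_class C M (Fa p) \<longleftrightarrow>
        p' \<in> M\<^sub>F \<and> Cod A p' = X \<and> factors_through C (Fa p) (Fa p') \<and> factors_through C (Fa p') (Fa p)"
      using C.mem_sub_class_iff[OF M\<^sub>F_D(2)[OF p(1)]] Cod_Fa[of p'] Cod_Fa[OF M\<^sub>F_D(1)[OF p(1)]] p(2)
      by (auto simp: lift_M_def Ini_def)
    also have "\<dots> \<longleftrightarrow> p' \<in> sub_class A M\<^sub>F p"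
      using p M\<^sub>F_factors_iff[OF p(1), of p'] M\<^sub>F_factors_iff[of p' p] M\<^sub>F_D(1)[of p'] M\<^sub>F_D(1)[OF p(1)]
      by (auto simp: lifted.mem_sub_class_iff)
    finally show ?thesis .
  qed
  then show ?thesis unfolding delta_def by blast
qed

text \<open>Every subobject of \<open>Fo X\<close> is put into the form on which both
  \<open>gamma_sub_class\<close> and \<open>delta_sub_class\<close> compute.\<close>

lemma carrier_subC_E:
  assumes "X \<in> Obj A" "d \<in> carrier (subC X)"
  obtains p where "p \<in> M\<^sub>F" "Cod A p = X" "d = sub_class C M (Fa p)"
  using assms by (metis C.carrier_subobjE M_lifting)

lemma gamma_in_carrier: "c \<in> carrier (subA X) \<Longrightarrow> \<gamma> X c \<in> carrier (subC X)"
  by (metis lifted.carrier_subobjE gamma_sub_class C.sub_class_in_carrier M\<^sub>F_D(1,2) Cod_Fa)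

lemma delta_in_carrier: "\<lbrakk>X \<in> Obj A; d \<in> carrier (subC X)\<rbrakk> \<Longrightarrow> \<delta> X d \<in> carrier (subA X)"
  by (metis carrier_subC_E delta_sub_class lifted.sub_class_in_carrier)

lemma gamma_delta: "\<lbrakk>X \<in> Obj A; d \<in> carrier (subC X)\<rbrakk> \<Longrightarrow> \<gamma> X (\<delta> X d) = d"
  by (metis carrier_subC_E gamma_sub_class delta_sub_class)

lemma gamma_le_iff:
  assumes "c \<in> carrier (subA X)" "d \<in> carrier (subA X)"
  shows "\<gamma> X c \<sqsubseteq>\<^bsub>subC X\<^esub> \<gamma> X d \<longleftrightarrow> c \<sqsubseteq>\<^bsub>subA X\<^esub> d"
proof -
  obtain m where "m \<in> M\<^sub>F" "Cod A m = X" "c = sub_class A M\<^sub>F m"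
    using assms(1) by (rule lifted.carrier_subobjE)
  moreover obtain n where "n \<in> M\<^sub>F" "Cod A n = X" "d = sub_class A M\<^sub>F n"
    using assms(2) by (rule lifted.carrier_subobjE)
  ultimately show ?thesis
    by (simp add: M\<^sub>F_D M\<^sub>F_factors_iff gamma_sub_class lifted.sub_class_le_iff C.sub_class_le_iff)
qed

text \<open>The order equivalence in adjunction form. Nearly every inequality in \<open>A\<close>
  against a lifted map is moved to \<open>C\<close> by this rule.\<close>

lemma le_delta_iff:
  "\<lbrakk>X \<in> Obj A; c \<in> carrier (subA X); d \<in> carrier (subC X)\<rbrakk>
    \<Longrightarrow> c \<sqsubseteq>\<^bsub>subA X\<^esub> \<delta> X d \<longleftrightarrow> \<gamma> X c \<sqsubseteq>\<^bsub>subC X\<^esub> d"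
  by (metis gamma_le_iff gamma_delta delta_in_carrier)

lemma delta_le_iff:
  "\<lbrakk>X \<in> Obj A; c \<in> carrier (subC X); d \<in> carrier (subC X)\<rbrakk>
    \<Longrightarrow> \<delta> X c \<sqsubseteq>\<^bsub>subA X\<^esub> \<delta> X d \<longleftrightarrow> c \<sqsubseteq>\<^bsub>subC X\<^esub> d"
  by (simp add: le_delta_iff delta_in_carrier gamma_delta)

text \<open>\<open>F\<close> carries a factorization in \<open>A\<close> to one in \<open>C\<close>,
  as it sends \<open>E\<^sub>F\<close> into \<open>E\<close> and \<open>M\<^sub>F\<close> into
  \<open>M\<close>; by \<open>sub_image_sub_class\<close> one factorization on each side is
  enough.\<close>

lemma gamma_sub_image:
  assumes f: "f \<in> Hom A X Y" and c: "c \<in> carrier (subA X)"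
  shows "\<gamma> Y (sub_image A E\<^sub>F M\<^sub>F f c) = sub_image C E M (Fa f) (\<gamma> X c)"
proof -
  have fA: "f \<in> Arr A" "Dom A f = X" "Cod A f = Y" using f by (auto simp: Hom_def)
  obtain m where m: "m \<in> M\<^sub>F" "Cod A m = X" "c = sub_class A M\<^sub>F m"
    using c by (rule lifted.carrier_subobjE)
  have mH: "m \<in> Hom A (Dom A m) X" using M\<^sub>F_D(1)[OF m(1)] m(2) by (simp add: Hom_def)
  obtain e n where e: "e \<in> E\<^sub>F" "n \<in> M\<^sub>F" "Cod A e = Dom A n" "n \<cdot>\<^bsub>A\<^esub> e = f \<cdot>\<^bsub>A\<^esub> m"
    using lifted.factorization A.Hom_Arr[OF A.Comp_in_Hom[OF mH f]] by metis
  have eE: "e \<in> Arr A" "Fa e \<in> E" using e by (auto simp: lift_E_def)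
  have img: "sub_image A E\<^sub>F M\<^sub>F f c = sub_class A M\<^sub>F n" "Cod A n = Y"
    using lifted.sub_image_sub_class[OF fA(1) m(1) _ e(2,1,3,4)] m fA by auto
  have eH: "e \<in> Hom A (Dom A e) (Dom A n)" using eE e by (simp add: Hom_def)
  have "Fa n \<cdot>\<^bsub>C\<^esub> Fa e = Fa f \<cdot>\<^bsub>C\<^esub> Fa m"
    using Fa_Comp[OF eH A.Arr_Hom[OF M\<^sub>F_D(1)[OF e(2)]]] Fa_Comp[OF mH f] e(4) by simp
  then have "sub_image C E M (Fa f) (sub_class C M (Fa m)) = sub_class C M (Fa n)"
    using C.sub_image_sub_class(1)[of "Fa f" "Fa m" "Fa n" "Fa e"] fA m e eE
    by (simp add: M\<^sub>F_D Fa_Arr Dom_Fa Cod_Fa)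
  then show ?thesis using img m e gamma_sub_class by simp
qed

lemma gamma_sub_inv_image:
  assumes f: "f \<in> Hom A X Y" and c: "c \<in> carrier (subA Y)"
  shows "\<gamma> X (sub_inv_image A f c) = sub_inv_image C (Fa f) (\<gamma> Y c)"
proof -
  have fA: "f \<in> Arr A" "Dom A f = X" "Cod A f = Y" using f by (auto simp: Hom_def)
  obtain n where n: "n \<in> M\<^sub>F" "Cod A n = Y" "c = sub_class A M\<^sub>F n"
    using c by (rule lifted.carrier_subobjE)
  obtain p q q' where "p \<in> M\<^sub>F" "Cod A p = X" "is_pullback A f n p q"
      "is_pullback C (Fa f) (Fa n) (Fa p) q'"
    using ex_lifted_pullback[OF fA(1) n(1)] n fA by metis
  then show ?thesis
    using n gamma_sub_class lifted.sub_inv_image_sub_class[of n p f q]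
      C.sub_inv_image_sub_class[of "Fa n" "Fa p" "Fa f" q'] by (simp add: M\<^sub>F_D)
qed

text \<open>Each inequality uses the universal property of one of the two meets, with the order
  equivalence moving the comparison between \<open>A\<close> and \<open>C\<close>.\<close>

lemma delta_meet:
  assumes X: "X \<in> Obj A" and c: "c \<in> carrier (subC X)" and d: "d \<in> carrier (subC X)"
  shows "\<delta> X (c \<sqinter>\<^bsub>subC X\<^esub> d) = \<delta> X c \<sqinter>\<^bsub>subA X\<^esub> \<delta> X d"
proof -
  interpret a: lower_semilattice "subA X" by (rule lifted.lower_semilattice_subobj[OF X])
  interpret c: lower_semilattice "subC X" by (rule C.lower_semilattice_subobj[OF Fo_in_Obj[OF X]])
  note in_carrier = c d c.meet_closed[OF c d] delta_in_carrier[OF X] gamma_in_carrier a.meet_closed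
  show ?thesis
  proof (rule a.le_antisym)
    show "\<delta> X (c \<sqinter>\<^bsub>subC X\<^esub> d) \<sqsubseteq>\<^bsub>subA X\<^esub> \<delta> X c \<sqinter>\<^bsub>subA X\<^esub> \<delta> X d"
      using X by (intro a.meet_le) (simp_all add: in_carrier delta_le_iff c.meet_left c.meet_right)
    have "\<gamma> X (\<delta> X c \<sqinter>\<^bsub>subA X\<^esub> \<delta> X d) \<sqsubseteq>\<^bsub>subC X\<^esub> c \<sqinter>\<^bsub>subC X\<^esub> d"
      using X by (intro c.meet_le) (simp_all add: in_carrier le_delta_iff[symmetric] a.meet_left a.meet_right)
    then show "\<delta> X c \<sqinter>\<^bsub>subA X\<^esub> \<delta> X d \<sqsubseteq>\<^bsub>subA X\<^esub> \<delta> X (c \<sqinter>\<^bsub>subC X\<^esub> d)"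
      using X by (simp add: in_carrier le_delta_iff)
  qed (simp_all add: in_carrier)
qed


section \<open>The lifted quasi-uniformity\<close>

definition lift_map :: "'p \<Rightarrow> ('a set \<Rightarrow> 'a set) \<Rightarrow> 'b set \<Rightarrow> 'b set" where
  "lift_map X U = (\<lambda>m\<in>carrier (subA X). \<delta> X (U (\<gamma> X m)))"

lemma lift_base_eq: "lift_base A C Fo Fa M B X = lift_map X ` B (Fo X)"
  by (auto simp: lift_base_def lift_map_def)

lemma sub_maps_in_carrier:
  "\<lbrakk>U \<in> sub_maps K N Y; c \<in> carrier (subobj K N Y)\<rbrakk> \<Longrightarrow> U c \<in> carrier (subobj K N Y)"
  by (auto simp: sub_maps_def PiE_iff)

lemma gamma_lift_map:
  "\<lbrakk>X \<in> Obj A; U \<in> sub_maps C M (Fo X); c \<in> carrier (subA X)\<rbrakk>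
    \<Longrightarrow> \<gamma> X (lift_map X U c) = U (\<gamma> X c)"
  by (simp add: lift_map_def gamma_delta gamma_in_carrier sub_maps_in_carrier)

lemma lift_map_in_sub_maps:
  assumes X: "X \<in> Obj A" and U: "U \<in> sub_maps C M (Fo X)"
  shows "lift_map X U \<in> sub_maps A M\<^sub>F X"
proof -
  have "isotone (subC X) (subC X) U" using U by (simp add: sub_maps_def)
  then have mono: "U c \<sqsubseteq>\<^bsub>subC X\<^esub> U d"
    if "c \<in> carrier (subC X)" "d \<in> carrier (subC X)" "c \<sqsubseteq>\<^bsub>subC X\<^esub> d" for c d
    using that by (auto simp: isotone_def)
  have "weak_partial_order (subA X)"
    using lifted.partial_order_subobj by (rule partial_order.axioms)
  then show ?thesis
    using U X mono unfolding sub_maps_def isotone_def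
    by (auto simp: lift_map_def PiE_iff delta_in_carrier gamma_in_carrier delta_le_iff gamma_le_iff)
qed

lemma lift_map_mono:
  "\<lbrakk>X \<in> Obj A; U \<in> sub_maps C M (Fo X); V \<in> sub_maps C M (Fo X); map_le C M (Fo X) U V\<rbrakk>
    \<Longrightarrow> map_le A M\<^sub>F X (lift_map X U) (lift_map X V)"
  by (auto simp: map_le_def lift_map_def delta_le_iff gamma_in_carrier sub_maps_in_carrier)

text \<open>The inner \<gamma> \<circ> \<delta> cancels. As the maps are extensional this is an
  equality of functions, which serves both \<open>U2\<close> and transitivity.\<close>

lemma compose_lift_map:
  assumes "X \<in> Obj A" "U \<in> sub_maps C M (Fo X)" "V \<in> sub_maps C M (Fo X)"
  shows "compose (carrier (subA X)) (lift_map X U) (lift_map X V) =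
    lift_map X (compose (carrier (subC X)) U V)"
  using assms
  by (auto simp: fun_eq_iff compose_def lift_map_def gamma_delta delta_in_carrier gamma_in_carrier
      sub_maps_in_carrier)

lemma map_meet_lift_map:
  assumes "X \<in> Obj A" "U \<in> sub_maps C M (Fo X)" "V \<in> sub_maps C M (Fo X)"
  shows "map_meet A M\<^sub>F X (lift_map X U) (lift_map X V) = lift_map X (map_meet C M (Fo X) U V)"
  using assms
  by (auto simp: fun_eq_iff map_meet_def lift_map_def delta_meet gamma_in_carrier sub_maps_in_carrier)

lemma compose_in_sub_maps:
  assumes "U \<in> sub_maps C M X" "V \<in> sub_maps C M X"
  shows "compose (carrier (subobj C M X)) U V \<in> sub_maps C M X"
  using assms by (auto simp: sub_maps_def isotone_def compose_def PiE_iff)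

context
  fixes B :: "('o, 'a) sub_map_family"
  assumes base: "qu_base C E M B"
begin

abbreviation "B\<^sub>F \<equiv> lift_base A C Fo Fa M B"
abbreviation "\<U> \<equiv> generated C M B"
abbreviation "\<U>\<^sub>F \<equiv> generated A M\<^sub>F B\<^sub>F"

lemma base_in_sub_maps: "\<lbrakk>X \<in> Obj A; U \<in> B (Fo X)\<rbrakk> \<Longrightarrow> U \<in> sub_maps C M (Fo X)"
  using qu_base.maps[OF base] Fo_in_Obj by blast

lemma qu_base_lift_base: "qu_base A E\<^sub>F M\<^sub>F B\<^sub>F"
proof
  fix X assume X: "X \<in> Obj A"
  note FX = Fo_in_Obj[OF X]
  show "B\<^sub>F X \<subseteq> sub_maps A M\<^sub>F X"
    using lift_map_in_sub_maps base_in_sub_maps X by (auto simp: lift_base_eq)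
  fix V assume "V \<in> B\<^sub>F X"
  then obtain U where U: "U \<in> B (Fo X)" "V = lift_map X U" by (auto simp: lift_base_eq)
  note UM = base_in_sub_maps[OF X U(1)]
  \<comment> \<open>By adjunction this is \<open>U1\<close> for \<open>U\<close> at the subobject
    \<open>\<gamma> X c\<close>.\<close>
  show "c \<sqsubseteq>\<^bsub>subA X\<^esub> V c" if c: "c \<in> carrier (subA X)" for c
    using qu_base.U1[OF base FX U(1) gamma_in_carrier[OF c]] X UM c
    by (simp add: U(2) lift_map_def le_delta_iff gamma_in_carrier sub_maps_in_carrier)
  obtain U' where U': "U' \<in> B (Fo X)" "map_le C M (Fo X) (compose (carrier (subC X)) U' U') U"
    using qu_base.U2[OF base FX U(1)] by blast
  note U'M = base_in_sub_maps[OF X U'(1)]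
  have "map_le A M\<^sub>F X (compose (carrier (subA X)) (lift_map X U') (lift_map X U')) V"
    using lift_map_mono[OF X compose_in_sub_maps[OF U'M U'M] UM U'(2)] compose_lift_map[OF X U'M U'M] U(2)
    by simp
  then show "\<exists>V'\<in>B\<^sub>F X. map_le A M\<^sub>F X (compose (carrier (subA X)) V' V') V"
    using U'(1) by (auto simp: lift_base_eq)
  fix V' assume "V' \<in> B\<^sub>F X"
  then obtain U'' where U'': "U'' \<in> B (Fo X)" "V' = lift_map X U''" by (auto simp: lift_base_eq)
  show "map_meet A M\<^sub>F X V V' \<in> B\<^sub>F X"
    using map_meet_lift_map[OF X UM base_in_sub_maps[OF X U''(1)]] U U''
      qu_base.U4[OF base FX U(1) U''(1)] by (auto simp: lift_base_eq)
next
  fix f X Y V assume f: "f \<in> Hom A X Y" and "V \<in> B\<^sub>F Y"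
  then obtain U where U: "U \<in> B (Fo Y)" "V = lift_map Y U" by (auto simp: lift_base_eq)
  have X: "X \<in> Obj A" and Y: "Y \<in> Obj A"
    using f A.Dom_in_Obj A.Cod_in_Obj by (auto simp: Hom_def)
  obtain U' where U': "U' \<in> B (Fo X)" "\<forall>m\<in>carrier (subC X).
      sub_image C E M (Fa f) (U' m) \<sqsubseteq>\<^bsub>subC Y\<^esub> U (sub_image C E M (Fa f) m)"
    using qu_base.U5[OF base Fa_in_Hom[OF f] U(1)] by blast
  note UM = base_in_sub_maps[OF Y U(1)]
  note U'M = base_in_sub_maps[OF X U'(1)]
  note LU'M = lift_map_in_sub_maps[OF X U'M]
  have "sub_image A E\<^sub>F M\<^sub>F f (lift_map X U' c) \<sqsubseteq>\<^bsub>subA Y\<^esub> V (sub_image A E\<^sub>F M\<^sub>F f c)"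
    if c: "c \<in> carrier (subA X)" for c
  proof -
    have fc: "sub_image A E\<^sub>F M\<^sub>F f c \<in> carrier (subA Y)"
      by (rule lifted.sub_image_in_carrier[OF f c])
    have Uc: "lift_map X U' c \<in> carrier (subA X)" by (rule sub_maps_in_carrier[OF LU'M c])
    \<comment> \<open>The comparison is made in \<open>C\<close>, where it is \<open>U5\<close> for
      \<open>Fa f\<close> at \<open>\<gamma> X c\<close>; \<open>le_delta_iff\<close> brings it back
      to \<open>A\<close>.\<close>
    have "\<gamma> Y (sub_image A E\<^sub>F M\<^sub>F f (lift_map X U' c)) = sub_image C E M (Fa f) (U' (\<gamma> X c))"
      using gamma_sub_image[OF f Uc] gamma_lift_map[OF X U'M c] by simp
    also have "\<dots> \<sqsubseteq>\<^bsub>subC Y\<^esub> U (sub_image C E M (Fa f) (\<gamma> X c))"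
      using U'(2) gamma_in_carrier[OF c] by blast
    also have "\<dots> = U (\<gamma> Y (sub_image A E\<^sub>F M\<^sub>F f c))" using gamma_sub_image[OF f c] by simp
    finally show ?thesis
      using lifted.sub_image_in_carrier[OF f Uc] fc Y UM
      by (simp add: U(2) lift_map_def le_delta_iff gamma_in_carrier sub_maps_in_carrier)
  qed
  then show "\<exists>V'\<in>B\<^sub>F X. \<forall>m\<in>carrier (subA X).
      sub_image A E\<^sub>F M\<^sub>F f (V' m) \<sqsubseteq>\<^bsub>subA Y\<^esub> V (sub_image A E\<^sub>F M\<^sub>F f m)"
    using U'(1) by (auto simp: lift_base_eq)
qed

text \<open>Needed beyond base members: continuity quantifies over the whole generated family, and
  initiality of \<open>Fa f\<close> supplies witnesses from that family.\<close>

lemma lift_map_in_generated: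
  assumes X: "X \<in> Obj A" and V: "V \<in> \<U> (Fo X)"
  shows "lift_map X V \<in> \<U>\<^sub>F X"
proof -
  have VM: "V \<in> sub_maps C M (Fo X)" using V by (simp add: generated_def)
  obtain U where U: "U \<in> B (Fo X)" "map_le C M (Fo X) U V" using V by (auto simp: generated_def)
  then show ?thesis
    using lift_map_in_sub_maps[OF X VM] lift_map_mono[OF X base_in_sub_maps[OF X U(1)] VM U(2)]
    by (auto simp: generated_def lift_base_eq)
qed

lemma lifted_generatedE:
  assumes "V \<in> \<U>\<^sub>F X"
  obtains U where "U \<in> B (Fo X)" "map_le A M\<^sub>F X (lift_map X U) V" "V \<in> sub_maps A M\<^sub>F X"
  using assms by (auto simp: generated_def lift_base_eq)

section \<open>Continuity, minimality, transitivity and initiality\<close>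

lemma qu_continuous_lifted: "qu_continuous A C Fo Fa M \<U>\<^sub>F \<U>"
  unfolding qu_continuous_def
proof (intro ballI)
  fix X U assume X: "X \<in> Obj A" and U: "U \<in> \<U> (Fo X)"
  then have UM: "U \<in> sub_maps C M (Fo X)" by (simp add: generated_def)
  have "\<gamma> X (lift_map X U c) \<sqsubseteq>\<^bsub>subC X\<^esub> U (\<gamma> X c)" if c: "c \<in> carrier (subA X)" for c
    using gamma_lift_map[OF X UM c] C.subobj_refl[OF sub_maps_in_carrier[OF UM gamma_in_carrier[OF c]]]
    by simp
  then show "\<exists>W\<in>\<U>\<^sub>F X. \<forall>m\<in>carrier (subA X). \<gamma> X (W m) \<sqsubseteq>\<^bsub>subC X\<^esub> U (\<gamma> X m)"
    using lift_map_in_generated[OF X U] by blast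
qed

lemma lifted_coarsest:
  assumes W: "quasi_uniformity A E\<^sub>F M\<^sub>F \<W>" and cont: "qu_continuous A C Fo Fa M \<W> \<U>"
  shows "qu_le A M\<^sub>F \<U>\<^sub>F \<W>"
  unfolding qu_le_def
proof (intro ballI)
  fix X V assume X: "X \<in> Obj A" and V: "V \<in> \<U>\<^sub>F X"
  obtain U where U: "U \<in> B (Fo X)" "map_le A M\<^sub>F X (lift_map X U) V" "V \<in> sub_maps A M\<^sub>F X"
    using V by (rule lifted_generatedE)
  note UM = base_in_sub_maps[OF X U(1)]
  have "U \<in> \<U> (Fo X)" by (rule C.base_subset_generated[OF base Fo_in_Obj[OF X] U(1)])
  then obtain W where W': "W \<in> \<W> X" "\<forall>m\<in>carrier (subA X). \<gamma> X (W m) \<sqsubseteq>\<^bsub>subC X\<^esub> U (\<gamma> X m)"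
    using cont X unfolding qu_continuous_def by blast
  have WM: "W \<in> sub_maps A M\<^sub>F X"
    using qu_base.maps[OF quasi_uniformity.axioms(1)[OF W] X] W'(1) by blast
  \<comment> \<open>Under \<open>le_delta_iff\<close> this is literally the continuity inequality
    for \<open>W\<close> and \<open>U\<close>.\<close>
  have "map_le A M\<^sub>F X W (lift_map X U)"
    unfolding map_le_def using W' WM UM X
    by (auto simp: lift_map_def le_delta_iff gamma_in_carrier sub_maps_in_carrier)
  then have "map_le A M\<^sub>F X W V"
    using lifted.map_le_trans[OF WM lift_map_in_sub_maps[OF X UM] U(3)] U(2) by blast
  then show "\<exists>W\<in>\<W> X. map_le A M\<^sub>F X W V" using W'(1) by blast
qed

lemma transitive_lift_base:
  assumes "transitive_base C M B"
  shows "transitive_base A M\<^sub>F B\<^sub>F"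
  using assms base_in_sub_maps compose_lift_map Fo_in_Obj
  unfolding transitive_base_def by (auto simp: lift_base_eq)

text \<open>Since \<open>\<gamma>\<close> commutes with images, inverse images and lifted maps, the
  initiality inequality for a lifted \<open>U\<close> at \<open>c\<close> is the one for
  \<open>U\<close> at \<open>\<gamma> X c\<close>. The witness is therefore the lift of the witness
  for \<open>Fa f\<close>.\<close>

lemma qu_initial_lifted:
  assumes f: "f \<in> Arr A" and ini: "qu_initial C E M \<U> (Fa f)"
  shows "qu_initial A E\<^sub>F M\<^sub>F \<U>\<^sub>F f"
  unfolding qu_initial_def
proof
  fix V assume V: "V \<in> \<U>\<^sub>F (Dom A f)"
  define X where "X = Dom A f"
  define Y where "Y = Cod A f"
  have fH: "f \<in> Hom A X Y" using f by (simp add: X_def Y_def Hom_def)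
  have X: "X \<in> Obj A" and Y: "Y \<in> Obj A" using f A.Dom_in_Obj A.Cod_in_Obj by (auto simp: X_def Y_def)
  obtain U where U: "U \<in> B (Fo X)" "map_le A M\<^sub>F X (lift_map X U) V" "V \<in> sub_maps A M\<^sub>F X"
    using V unfolding X_def by (rule lifted_generatedE)
  note UM = base_in_sub_maps[OF X U(1)]
  have "U \<in> \<U> (Fo X)" by (rule C.base_subset_generated[OF base Fo_in_Obj[OF X] U(1)])
  then obtain U' where U': "U' \<in> \<U> (Fo Y)" "\<forall>p\<in>carrier (subC X).
      sub_inv_image C (Fa f) (U' (sub_image C E M (Fa f) p)) \<sqsubseteq>\<^bsub>subC X\<^esub> U p"
    using ini f unfolding qu_initial_def by (auto simp: Dom_Fa Cod_Fa X_def Y_def)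
  have U'M: "U' \<in> sub_maps C M (Fo Y)" using U'(1) by (simp add: generated_def)
  have "sub_inv_image A f (lift_map Y U' (sub_image A E\<^sub>F M\<^sub>F f c)) \<sqsubseteq>\<^bsub>subA X\<^esub> V c"
    if c: "c \<in> carrier (subA X)" for c
  proof -
    have fc: "sub_image A E\<^sub>F M\<^sub>F f c \<in> carrier (subA Y)" by (rule lifted.sub_image_in_carrier[OF fH c])
    have Ufc: "lift_map Y U' (sub_image A E\<^sub>F M\<^sub>F f c) \<in> carrier (subA Y)"
      by (rule sub_maps_in_carrier[OF lift_map_in_sub_maps[OF Y U'M] fc])
    have inv: "sub_inv_image A f (lift_map Y U' (sub_image A E\<^sub>F M\<^sub>F f c)) \<in> carrier (subA X)"
      by (rule lifted.sub_inv_image_in_carrier[OF fH Ufc])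
    have "\<gamma> X (sub_inv_image A f (lift_map Y U' (sub_image A E\<^sub>F M\<^sub>F f c))) =
        sub_inv_image C (Fa f) (U' (sub_image C E M (Fa f) (\<gamma> X c)))"
      using gamma_sub_inv_image[OF fH Ufc] gamma_lift_map[OF Y U'M fc] gamma_sub_image[OF fH c] by simp
    also have "\<dots> \<sqsubseteq>\<^bsub>subC X\<^esub> U (\<gamma> X c)" using U'(2) gamma_in_carrier[OF c] by blast
    \<comment> \<open>The bound obtained in \<open>C\<close> returns to \<open>A\<close> by
      \<open>le_delta_iff\<close>, giving the lift of the base member \<open>U\<close>;
      \<open>V\<close> lies above that lift.\<close>
    finally have "sub_inv_image A f (lift_map Y U' (sub_image A E\<^sub>F M\<^sub>F f c)) \<sqsubseteq>\<^bsub>subA X\<^esub> lift_map X U c"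
      using X UM c inv by (simp add: lift_map_def le_delta_iff gamma_in_carrier sub_maps_in_carrier)
    moreover have "lift_map X U c \<sqsubseteq>\<^bsub>subA X\<^esub> V c" using U(2) c by (simp add: map_le_def)
    ultimately show ?thesis
      using lifted.subobj_trans inv sub_maps_in_carrier[OF lift_map_in_sub_maps[OF X UM] c]
        sub_maps_in_carrier[OF U(3) c] by blast
  qed
  then show "\<exists>V'\<in>\<U>\<^sub>F (Cod A f). \<forall>p\<in>carrier (subA (Dom A f)).
      sub_inv_image A f (V' (sub_image A E\<^sub>F M\<^sub>F f p)) \<sqsubseteq>\<^bsub>subA (Dom A f)\<^esub> V p"
    using lift_map_in_generated[OF Y U'(1)] unfolding X_def Y_def by blast
qed

end

end

theorem theorem4:
  fixes A :: "('p, 'b) category" and C :: "('o, 'a) category"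
    and Fo :: "'p \<Rightarrow> 'o" and Fa :: "'b \<Rightarrow> 'a"
    and E M :: "'a set" and E\<^sub>F M\<^sub>F :: "'b set"
    and B \<U> :: "('o, 'a) sub_map_family" and B\<^sub>F \<U>\<^sub>F :: "('p, 'b) sub_map_family"
  assumes "proper_factorization_system C E M" and "M_complete C M"
    and "M_fibration A C Fo Fa M"
    and "qu_base C E M B" and "\<U> = generated C M B"
    and "E\<^sub>F = lift_E A Fa E" and "M\<^sub>F = lift_M A C Fo Fa M"
    and "B\<^sub>F = lift_base A C Fo Fa M B" and "\<U>\<^sub>F = generated A M\<^sub>F B\<^sub>F"
  shows "qu_base A E\<^sub>F M\<^sub>F B\<^sub>F \<and> quasi_uniformity A E\<^sub>F M\<^sub>F \<U>\<^sub>F \<and>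
    qu_continuous A C Fo Fa M \<U>\<^sub>F \<U> \<and>
    (\<forall>\<W>. quasi_uniformity A E\<^sub>F M\<^sub>F \<W> \<and> qu_continuous A C Fo Fa M \<W> \<U> \<longrightarrow>
       qu_le A M\<^sub>F \<U>\<^sub>F \<W>) \<and>
    (transitive_base C M B \<longrightarrow> transitive_base A M\<^sub>F B\<^sub>F) \<and>
    (\<forall>f\<in>Arr A. qu_initial C E M \<U> (Fa f) \<longrightarrow> qu_initial A E\<^sub>F M\<^sub>F \<U>\<^sub>F f)"
proof -
  interpret complete_fibration A C Fo Fa E M
    using assms(1-3)
    by (intro complete_fibration.intro complete_factorization_system.intro
        complete_factorization_system_axioms.intro)
  show ?thesis
    unfolding assms(5-9)
    using qu_base_lift_base lifted.quasi_uniformity_generated qu_continuous_lifted lifted_coarsest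
      transitive_lift_base qu_initial_lifted assms(4) by blast
qed

end
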